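(* The category $\mathrm{Mon}$ of monoids is not locally algebraically cartesian closed. Moreover, for a monoid $B$, the functor $K\colon \mathrm{SpEx}_B(\mathrm{Mon})\to \mathrm{Mon}$, sending a split extension of monoids $(A\xrightarrow{\kappa} G\underset{s}{\overset{p}{\rightleftarrows}} B)$ over $B$ to $A$, has a right adjoint if and only if $B$ is a Dedekind-finite monoid.
   Context: For a pointed category $\mathbb{X}$ and an object $B$, a split extension over $B$ consists of morphisms $\kappa\colon A\to G$, $p\colon G\to B$, $s\colon B\to G$ in $\mathbb{X}$ such that $\kappa$ is a kernel of $p$, $p$ is a cokernel of $\kappa$, and $p\circ s=\mathrm{id}_B$. The category $\mathrm{SpEx}_B(\mathbb{X})$ has these as objects; a morphism from $(A,G,\kappa,p,s)$ to $(A',G',\kappa',p',s')$ is a pair of morphisms $\phi_A\colon A\to A'$, $\phi_G\colon G\to G'$ with $\phi_G\circ\kappa=\kappa'\circ\phi_A$, $p'\circ\phi_G=p$ and $\phi_G\circ s=s'$. The functor $K_{\mathbb{X}}\colon\mathrm{SpEx}_B(\mathbb{X})\to\mathbb{X}$ sends $(A,G,\kappa,p,s)$ to $A$ and $(\phi_A,\phi_G)$ to $\phi_A$; in the claim $K=K_{\mathrm{Mon}}$. $\mathbb{X}$ is locally algebraically cartesian closed (LACC) if for every object $B$ of $\mathbb{X}$ the functor $K_{\mathbb{X}}\colon\mathrm{SpEx}_B(\mathbb{X})\to\mathbb{X}$ has a right adjoint. A monoid $M$ is Dedekind-finite if for all $x,y\in M$, $xy=1_M$ implies $yx=1_M$.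 *)

theory Defs
  imports "HOL-Algebra.Group" "HOL-Library.Equipollence"
begin

section \<open>Categories, functors, adjoints\<close>

record ('o, 'm) cat =
  Ob  :: "'o set"
  Ar  :: "'m set"
  Dom :: "'m \<Rightarrow> 'o"
  Cod :: "'m \<Rightarrow> 'o"
  Idn :: "'o \<Rightarrow> 'm"
  Cmp :: "'m \<Rightarrow> 'm \<Rightarrow> 'm"  (infixl "\<cdot>\<index>" 70)

definition Hom :: "('o, 'm) cat \<Rightarrow> 'o \<Rightarrow> 'o \<Rightarrow> 'm set" where
  "Hom C a b = {f \<in> Ar C. Dom C f = a \<and> Cod C f = b}"

locale category =
  fixes C :: "('o, 'm) cat" (structure)
  assumes dom_cod: "f \<in> Ar C \<Longrightarrow> Dom C f \<in> Ob C \<and> Cod C f \<in> Ob C"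
    and idn: "a \<in> Ob C \<Longrightarrow> Idn C a \<in> Hom C a a"
    and cmp: "\<lbrakk>f \<in> Hom C a b; g \<in> Hom C b c\<rbrakk> \<Longrightarrow> g \<cdot> f \<in> Hom C a c"
    and idn_left: "f \<in> Hom C a b \<Longrightarrow> Idn C b \<cdot> f = f"
    and idn_right: "f \<in> Hom C a b \<Longrightarrow> f \<cdot> Idn C a = f"
    and assoc: "\<lbrakk>f \<in> Hom C a b; g \<in> Hom C b c; h \<in> Hom C c d\<rbrakk> \<Longrightarrow> (h \<cdot> g) \<cdot> f = h \<cdot> (g \<cdot> f)"

text \<open>A functor is given by its object map and its arrow map.\<close>

record ('o, 'm, 'p, 'n) cfunctor =
  on_ob :: "'o \<Rightarrow> 'p"
  on_ar :: "'m \<Rightarrow> 'n"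

definition is_functor :: "('o, 'm) cat \<Rightarrow> ('p, 'n) cat \<Rightarrow> ('o, 'm, 'p, 'n) cfunctor \<Rightarrow> bool" where
  "is_functor C D F \<longleftrightarrow> category C \<and> category D \<and>
     (\<forall>a\<in>Ob C. on_ob F a \<in> Ob D) \<and>
     (\<forall>a b. \<forall>f\<in>Hom C a b. on_ar F f \<in> Hom D (on_ob F a) (on_ob F b)) \<and>
     (\<forall>a\<in>Ob C. on_ar F (Idn C a) = Idn D (on_ob F a)) \<and>
     (\<forall>a b c. \<forall>f\<in>Hom C a b. \<forall>g\<in>Hom C b c.
        on_ar F (g \<cdot>\<^bsub>C\<^esub> f) = on_ar F g \<cdot>\<^bsub>D\<^esub> on_ar F f)"

text \<open>\<open>R\<close> is right adjoint to \<open>F\<close>: there are bijections from \<open>Hom D (F e) x\<close> to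
  \<open>Hom C e (R x)\<close>, natural in \<open>e\<close> and \<open>x\<close>.\<close>

definition is_right_adjoint ::
  "('o, 'm) cat \<Rightarrow> ('p, 'n) cat \<Rightarrow> ('o, 'm, 'p, 'n) cfunctor \<Rightarrow> ('p, 'n, 'o, 'm) cfunctor \<Rightarrow> bool" where
  "is_right_adjoint C D F R \<longleftrightarrow> is_functor C D F \<and> is_functor D C R \<and>
     (\<exists>\<theta> :: 'o \<Rightarrow> 'p \<Rightarrow> 'n \<Rightarrow> 'm.
        (\<forall>e\<in>Ob C. \<forall>x\<in>Ob D.
           bij_betw (\<theta> e x) (Hom D (on_ob F e) x) (Hom C e (on_ob R x))) \<and>
        (\<forall>e'\<in>Ob C. \<forall>e\<in>Ob C. \<forall>x\<in>Ob D. \<forall>x'\<in>Ob D.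
           \<forall>u\<in>Hom C e' e. \<forall>f\<in>Hom D (on_ob F e) x. \<forall>v\<in>Hom D x x'.
             \<theta> e' x' (v \<cdot>\<^bsub>D\<^esub> (f \<cdot>\<^bsub>D\<^esub> on_ar F u)) = on_ar R v \<cdot>\<^bsub>C\<^esub> (\<theta> e x f \<cdot>\<^bsub>C\<^esub> u)))"

definition has_right_adjoint ::
  "('o, 'm) cat \<Rightarrow> ('p, 'n) cat \<Rightarrow> ('o, 'm, 'p, 'n) cfunctor \<Rightarrow> bool" where
  "has_right_adjoint C D F \<longleftrightarrow> (\<exists>R. is_right_adjoint C D F R)"


section \<open>Kernels, cokernels and split extensions\<close>

definition zero_object :: "('o, 'm) cat \<Rightarrow> 'o \<Rightarrow> bool" where
  "zero_object C z \<longleftrightarrow> z \<in> Ob C \<and>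
     (\<forall>a\<in>Ob C. (\<exists>!f. f \<in> Hom C a z) \<and> (\<exists>!f. f \<in> Hom C z a))"

definition pointed_category :: "('o, 'm) cat \<Rightarrow> bool" where
  "pointed_category C \<longleftrightarrow> category C \<and> (\<exists>z. zero_object C z)"

definition zero_arrow :: "('o, 'm) cat \<Rightarrow> 'm \<Rightarrow> bool" where
  "zero_arrow C f \<longleftrightarrow> (\<exists>z g h. zero_object C z \<and> g \<in> Hom C (Dom C f) z \<and>
     h \<in> Hom C z (Cod C f) \<and> f = h \<cdot>\<^bsub>C\<^esub> g)"

definition is_kernel :: "('o, 'm) cat \<Rightarrow> 'm \<Rightarrow> 'm \<Rightarrow> bool" where
  "is_kernel C k p \<longleftrightarrow> k \<in> Ar C \<and> p \<in> Ar C \<and> Cod C k = Dom C p \<and> zero_arrow C (p \<cdot>\<^bsub>C\<^esub> k) \<and>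
     (\<forall>x. \<forall>f\<in>Hom C x (Dom C p). zero_arrow C (p \<cdot>\<^bsub>C\<^esub> f) \<longrightarrow>
        (\<exists>!u. u \<in> Hom C x (Dom C k) \<and> k \<cdot>\<^bsub>C\<^esub> u = f))"

definition is_cokernel :: "('o, 'm) cat \<Rightarrow> 'm \<Rightarrow> 'm \<Rightarrow> bool" where
  "is_cokernel C p k \<longleftrightarrow> k \<in> Ar C \<and> p \<in> Ar C \<and> Cod C k = Dom C p \<and> zero_arrow C (p \<cdot>\<^bsub>C\<^esub> k) \<and>
     (\<forall>x. \<forall>f\<in>Hom C (Cod C k) x. zero_arrow C (f \<cdot>\<^bsub>C\<^esub> k) \<longrightarrow>
        (\<exists>!u. u \<in> Hom C (Cod C p) x \<and> u \<cdot>\<^bsub>C\<^esub> p = f))"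

record ('o, 'm) split_ext =
  ext_A :: 'o
  ext_G :: 'o
  ext_\<kappa> :: 'm
  ext_p :: 'm
  ext_s :: 'm

definition is_split_ext :: "('o, 'm) cat \<Rightarrow> 'o \<Rightarrow> ('o, 'm) split_ext \<Rightarrow> bool" where
  "is_split_ext C B E \<longleftrightarrow>
     ext_\<kappa> E \<in> Hom C (ext_A E) (ext_G E) \<and>
     ext_p E \<in> Hom C (ext_G E) B \<and>
     ext_s E \<in> Hom C B (ext_G E) \<and>
     is_kernel C (ext_\<kappa> E) (ext_p E) \<and>
     is_cokernel C (ext_p E) (ext_\<kappa> E) \<and>
     ext_p E \<cdot>\<^bsub>C\<^esub> ext_s E = Idn C B"

text \<open>An arrow of \<open>SpEx C B\<close> is a tuple \<open>(E, \<phi>A, \<phi>G, E')\<close> that records its domain and codomain.\<close>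

type_synonym ('o, 'm) spex_arrow = "('o, 'm) split_ext \<times> 'm \<times> 'm \<times> ('o, 'm) split_ext"

definition SpEx :: "('o, 'm) cat \<Rightarrow> 'o \<Rightarrow> (('o, 'm) split_ext, ('o, 'm) spex_arrow) cat" where
  "SpEx C B = \<lparr>
     Ob = {E. is_split_ext C B E},
     Ar = {(E, \<phi>A, \<phi>G, E'). is_split_ext C B E \<and> is_split_ext C B E' \<and>
             \<phi>A \<in> Hom C (ext_A E) (ext_A E') \<and> \<phi>G \<in> Hom C (ext_G E) (ext_G E') \<and>
             \<phi>G \<cdot>\<^bsub>C\<^esub> ext_\<kappa> E = ext_\<kappa> E' \<cdot>\<^bsub>C\<^esub> \<phi>A \<and>
             ext_p E' \<cdot>\<^bsub>C\<^esub> \<phi>G = ext_p E \<and>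
             \<phi>G \<cdot>\<^bsub>C\<^esub> ext_s E = ext_s E'},
     Dom = (\<lambda>(E, \<phi>A, \<phi>G, E'). E),
     Cod = (\<lambda>(E, \<phi>A, \<phi>G, E'). E'),
     Idn = (\<lambda>E. (E, Idn C (ext_A E), Idn C (ext_G E), E)),
     Cmp = (\<lambda>(E', \<psi>A, \<psi>G, E'') (E, \<phi>A, \<phi>G, _). (E, \<psi>A \<cdot>\<^bsub>C\<^esub> \<phi>A, \<psi>G \<cdot>\<^bsub>C\<^esub> \<phi>G, E''))\<rparr>"

definition ker_functor :: "(('o, 'm) split_ext, ('o, 'm) spex_arrow, 'o, 'm) cfunctor" where
  "ker_functor = \<lparr>on_ob = ext_A, on_ar = (\<lambda>(E, \<phi>A, \<phi>G, E'). \<phi>A)\<rparr>"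

definition LACC :: "('o, 'm) cat \<Rightarrow> bool" where
  "LACC C \<longleftrightarrow> (\<forall>B\<in>Ob C. has_right_adjoint (SpEx C B) C ker_functor)"


section \<open>The category of small monoids\<close>

text \<open>The objects of \<open>Mon U\<close> are the monoids whose carrier is a \<open>U\<close>-small set, i.e. a member of
  \<open>U\<close>, where \<open>U\<close> is a collection of subsets of a fixed type.  An arrow \<open>(M, f, N)\<close> records its
  domain and codomain, and \<open>f\<close> is \<open>undefined\<close> outside the carrier of \<open>M\<close>, so that arrows are equal
  if and only if they agree on that carrier.  (The constant \<^const>\<open>hom\<close> does not require units to
  be preserved.)\<close>

type_synonym 'u mon_arrow = "'u monoid \<times> ('u \<Rightarrow> 'u) \<times> 'u monoid"

definition Mon :: "'u set set \<Rightarrow> ('u monoid, 'u mon_arrow) cat" where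
  "Mon U = \<lparr>
     Ob = {M. monoid M \<and> carrier M \<in> U},
     Ar = {(M, f, N). monoid M \<and> carrier M \<in> U \<and> monoid N \<and> carrier N \<in> U \<and>
             f \<in> hom M N \<and> f \<one>\<^bsub>M\<^esub> = \<one>\<^bsub>N\<^esub> \<and> f \<in> extensional (carrier M)},
     Dom = (\<lambda>(M, f, N). M),
     Cod = (\<lambda>(M, f, N). N),
     Idn = (\<lambda>M. (M, restrict id (carrier M), M)),
     Cmp = (\<lambda>(N, g, P) (M, f, _). (M, compose (carrier M) g f, P))\<rparr>"

definition dedekind_finite :: "('a, 'b) monoid_scheme \<Rightarrow> bool" where
  "dedekind_finite M \<longleftrightarrow>
     (\<forall>x\<in>carrier M. \<forall>y\<in>carrier M. x \<otimes>\<^bsub>M\<^esub> y = \<one>\<^bsub>M\<^esub> \<longrightarrow> y \<otimes>\<^bsub>M\<^esub> x = \<one>\<^bsub>M\<^esub>)"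

text \<open>Smallness is only required to be a condition on cardinality that admits some infinite set.
  Full Grothendieck universes (the sets of cardinality less than an uncountable inaccessible
  cardinal) qualify, but HOL does not prove that one exists.  The only further closure property
  that matters is that the set of functions from the given monoid \<open>B\<close> to a small set is again
  small, up to bijection.  In a Grothendieck universe this holds for every small \<open>B\<close>.\<close>

definition size_universe :: "'u set set \<Rightarrow> bool" where
  "size_universe U \<longleftrightarrow> (\<forall>X\<in>U. \<forall>Y. Y \<lesssim> X \<longrightarrow> Y \<in> U) \<and> (\<exists>X\<in>U. infinite X)"

definition powers_small :: "'u set set \<Rightarrow> 'b set \<Rightarrow> bool" where
  "powers_small U B \<longleftrightarrow> (\<forall>X\<in>U. \<exists>Y\<in>U. (B \<rightarrow>\<^sub>E X) \<lesssim> Y)"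

text \<open>Both conditions are met when \<open>U\<close> consists of all subsets of a type that is large enough
  compared with \<open>B\<close>.  Such a type exists for every \<open>B\<close>.\<close>

lemma size_universe_UNIV: "infinite (UNIV :: 'u set) \<Longrightarrow> size_universe (UNIV :: 'u set set)"
  unfolding size_universe_def by auto

lemma powers_small_UNIV:
  fixes B :: "'c set"
  assumes "B \<lesssim> (UNIV :: 'b set)"
  shows "powers_small (UNIV :: (nat \<times> 'b \<Rightarrow> 'v) set set) B"
proof -
  obtain j :: "'c \<Rightarrow> 'b" where j: "inj_on j B"
    using assms by (auto simp: lepoll_def)
  have "infinite (UNIV :: (nat \<times> 'b) set)"
    by (simp add: finite_prod)
  from card_of_Times_same_infinite[OF this]
  obtain g :: "(nat \<times> 'b) \<times> (nat \<times> 'b) \<Rightarrow> nat \<times> 'b" where "bij_betw g (UNIV \<times> UNIV) UNIV"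
    unfolding card_of_ordIso[symmetric] ..
  then have g: "inj g"
    by (simp add: bij_betw_def)
  define h :: "'b \<times> nat \<times> 'b \<Rightarrow> nat \<times> 'b" where "h = (\<lambda>(b, w). g ((0, b), w))"
  have h: "inj h"
    by (rule injI) (auto simp: h_def dest: injD[OF g])
  define F :: "('c \<Rightarrow> nat \<times> 'b \<Rightarrow> 'v) \<Rightarrow> nat \<times> 'b \<Rightarrow> 'v" where
    "F f = (\<lambda>w. case inv_into UNIV h w of (b, z) \<Rightarrow> f (inv_into B j b) z)" for f
  have "inj_on F (B \<rightarrow>\<^sub>E UNIV)"
  proof (rule inj_onI, rule ext)
    fix f g :: "'c \<Rightarrow> nat \<times> 'b \<Rightarrow> 'v" and c
    assume f: "f \<in> B \<rightarrow>\<^sub>E UNIV" and g: "g \<in> B \<rightarrow>\<^sub>E UNIV" and eq: "F f = F g"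
    show "f c = g c"
    proof (cases "c \<in> B")
      case True
      have "F f (h (j c, z)) = f c z" "F g (h (j c, z)) = g c z" for z
        using True j h by (simp_all add: F_def)
      then show ?thesis using eq by (metis ext)
    next
      case False
      then show ?thesis using f g by (auto simp: PiE_def extensional_def)
    qed
  qed
  then have "(B \<rightarrow>\<^sub>E X) \<lesssim> (UNIV :: (nat \<times> 'b \<Rightarrow> 'v) set)" for X :: "(nat \<times> 'b \<Rightarrow> 'v) set"
    unfolding lepoll_def by (meson PiE_mono inj_on_subset subset_UNIV)
  then show ?thesis
    unfolding powers_small_def by blast
qed

text \<open>The same holds for the sets of cardinality less than that of a type of uncountable strong
  limit cardinality, in particular for Grothendieck universes.\<close>

lemma
  fixes U :: "'u set set"
  defines "U \<equiv> {X. X \<prec> (UNIV :: 'u set)}"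
  assumes "uncountable (UNIV :: 'u set)"
    and pow: "\<And>X Y. \<lbrakk>X \<in> U; Y \<in> U\<rbrakk> \<Longrightarrow> (X \<rightarrow>\<^sub>E Y) \<prec> (UNIV :: 'u set)"
  shows size_universe_strong_limit: "size_universe U"
    and powers_small_strong_limit: "B \<in> U \<Longrightarrow> powers_small U B"
proof -
  have "infinite (UNIV :: 'u set)"
    using assms(2) countable_finite by blast
  then obtain X :: "'u set" where X: "countable X" "infinite X"
    using infinite_countable_subset' by (metis)
  have "X \<lesssim> (UNIV :: 'u set)"
    by (simp add: subset_imp_lepoll)
  moreover have "\<not> (UNIV :: 'u set) \<lesssim> X"
    using X(1) assms(2) countable_lepoll by blast
  ultimately have "X \<prec> (UNIV :: 'u set)"
    unfolding lesspoll_def using eqpoll_imp_lepoll eqpoll_sym by blast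
  then show "size_universe U"
    using X unfolding size_universe_def U_def by (auto intro: lesspoll_trans1)
next
  assume B: "B \<in> U"
  show "powers_small U B"
    unfolding powers_small_def
  proof
    fix X assume "X \<in> U"
    then have less: "(B \<rightarrow>\<^sub>E X) \<prec> (UNIV :: 'u set)"
      using pow B by blast
    then obtain h :: "('u \<Rightarrow> 'u) \<Rightarrow> 'u" where h: "inj_on h (B \<rightarrow>\<^sub>E X)"
      by (auto simp: lesspoll_def lepoll_def)
    then have eq: "h ` (B \<rightarrow>\<^sub>E X) \<approx> (B \<rightarrow>\<^sub>E X)"
      by (rule inj_on_image_eqpoll_self)
    then have "h ` (B \<rightarrow>\<^sub>E X) \<in> U"
      using less unfolding U_def by (auto intro: eq_lesspoll_trans)
    then show "\<exists>Y\<in>U. (B \<rightarrow>\<^sub>E X) \<lesssim> Y"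
      using eq by (meson eqpoll_imp_lepoll eqpoll_sym)
  qed
qed


section \<open>Well-formedness\<close>

lemma category_Mon: "category (Mon U)"
proof (unfold_locales, goal_cases)
  case (1 f) then show ?case by (auto simp: Mon_def)
next
  case (2 a) then show ?case by (auto simp: Mon_def Hom_def hom_def monoid.m_closed)
next
  case (3 f a b g c)
  then show ?case
    by (auto simp: Mon_def Hom_def hom_def compose_def monoid.m_closed Pi_iff)
next
  case (4 f a b)
  then show ?case
    by (auto simp: Mon_def Hom_def hom_def compose_def Pi_iff extensional_def fun_eq_iff)
next
  case (5 f a b)
  then show ?case
    by (auto simp: Mon_def Hom_def hom_def compose_def Pi_iff extensional_def fun_eq_iff)
next
  case (6 f a b g c h d)
  then show ?case
    by (auto simp: Mon_def Hom_def hom_def compose_def Pi_iff fun_eq_iff)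
qed

lemma pointed_Mon:
  assumes "size_universe U"
  shows "pointed_category (Mon U)"
proof -
  obtain X where X: "X \<in> U" "infinite X" and down: "\<And>X Y. X \<in> U \<Longrightarrow> Y \<lesssim> X \<Longrightarrow> Y \<in> U"
    using assms unfolding size_universe_def by blast
  obtain z where z: "z \<in> X" using X(2) by fastforce
  have small: "{z} \<in> U"
    using down[OF X(1)] z by (meson empty_subsetI insert_subset subset_imp_lepoll)
  define Z :: "'a monoid" where "Z = \<lparr>carrier = {z}, mult = \<lambda>_ _. z, one = z\<rparr>"
  have Z: "monoid Z" by unfold_locales (auto simp: Z_def)
  have "zero_object (Mon U) Z"
    unfolding zero_object_def
  proof (intro conjI ballI)
    show "Z \<in> Ob (Mon U)" using Z small by (simp add: Mon_def Z_def)
  next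
    fix M assume "M \<in> Ob (Mon U)"
    then have M: "monoid M" "carrier M \<in> U" by (auto simp: Mon_def)
    show "\<exists>!f. f \<in> Hom (Mon U) M Z"
    proof (rule ex1I)
      show "(M, \<lambda>x\<in>carrier M. z, Z) \<in> Hom (Mon U) M Z"
        using M Z small by (auto simp: Hom_def Mon_def hom_def Z_def monoid.m_closed)
    next
      fix f assume "f \<in> Hom (Mon U) M Z"
      then show "f = (M, \<lambda>x\<in>carrier M. z, Z)"
        by (auto simp: Hom_def Mon_def hom_def Z_def extensional_def Pi_iff fun_eq_iff)
    qed
    show "\<exists>!f. f \<in> Hom (Mon U) Z M"
    proof (rule ex1I)
      show "(Z, \<lambda>x\<in>carrier Z. \<one>\<^bsub>M\<^esub>, M) \<in> Hom (Mon U) Z M"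
        using M Z small by (auto simp: Hom_def Mon_def hom_def Z_def monoid.l_one)
    next
      fix f assume "f \<in> Hom (Mon U) Z M"
      then show "f = (Z, \<lambda>x\<in>carrier Z. \<one>\<^bsub>M\<^esub>, M)"
        by (auto simp: Hom_def Mon_def Z_def extensional_def fun_eq_iff)
    qed
  qed
  then show ?thesis unfolding pointed_category_def using category_Mon by blast
qed

lemma Hom_SpEx:
  "(F, \<phi>A, \<phi>G, F') \<in> Hom (SpEx C B) E E' \<longleftrightarrow>
     F = E \<and> F' = E' \<and> is_split_ext C B E \<and> is_split_ext C B E' \<and>
     \<phi>A \<in> Hom C (ext_A E) (ext_A E') \<and> \<phi>G \<in> Hom C (ext_G E) (ext_G E') \<and>
     \<phi>G \<cdot>\<^bsub>C\<^esub> ext_\<kappa> E = ext_\<kappa> E' \<cdot>\<^bsub>C\<^esub> \<phi>A \<and> ext_p E' \<cdot>\<^bsub>C\<^esub> \<phi>G = ext_p E \<and> \<phi>G \<cdot>\<^bsub>C\<^esub> ext_s E = ext_s E'"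
  unfolding Hom_def[of "SpEx C B"] by (auto simp: SpEx_def)

lemma category_SpEx:
  fixes C :: "('o, 'm) cat" (structure)
  assumes "category C"
  shows "category (SpEx C B)"
proof -
  interpret category C by (rule assms)
  have ob: "ext_A E \<in> Ob C" "ext_G E \<in> Ob C" if "is_split_ext C B E" for E
    using that dom_cod[of "ext_\<kappa> E"] by (auto simp: is_split_ext_def Hom_def)
  have mor: "ext_\<kappa> E \<in> Hom C (ext_A E) (ext_G E)" "ext_p E \<in> Hom C (ext_G E) B"
    "ext_s E \<in> Hom C B (ext_G E)" if "is_split_ext C B E" for E
    using that by (auto simp: is_split_ext_def)
  have Idn: "Idn (SpEx C B) E = (E, Idn C (ext_A E), Idn C (ext_G E), E)" for E
    by (simp add: SpEx_def)
  have Cmp: "(E', c, d, E'') \<cdot>\<^bsub>SpEx C B\<^esub> (E, a, b, F) = (E, c \<cdot> a, d \<cdot> b, E'')" for E' c d E'' E a b F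
    by (simp add: SpEx_def)
  have arrow: "\<exists>a b. f = (E, a, b, E')" if "f \<in> Hom (SpEx C B) E E'" for f E E'
    using that by (cases f) (auto simp: Hom_SpEx)
  show ?thesis
  proof (unfold_locales, goal_cases)
    case (1 f) then show ?case by (auto simp: SpEx_def)
  next
    case (2 E)
    then have E: "is_split_ext C B E" by (simp add: SpEx_def)
    show ?case
      unfolding Idn Hom_SpEx
      by (simp add: E ob[OF E] idn idn_left[OF mor(1)[OF E]] idn_right[OF mor(1)[OF E]]
          idn_right[OF mor(2)[OF E]] idn_left[OF mor(3)[OF E]])
  next
    case (3 f E E' g E'')
    then obtain a b c d where f: "f = (E, a, b, E')" and g: "g = (E', c, d, E'')"
      using arrow by blast
    have E: "is_split_ext C B E" "is_split_ext C B E'" "is_split_ext C B E''"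
      and a: "a \<in> Hom C (ext_A E) (ext_A E')" "b \<in> Hom C (ext_G E) (ext_G E')"
      and c: "c \<in> Hom C (ext_A E') (ext_A E'')" "d \<in> Hom C (ext_G E') (ext_G E'')"
      and eq: "b \<cdot> ext_\<kappa> E = ext_\<kappa> E' \<cdot> a" "ext_p E' \<cdot> b = ext_p E" "b \<cdot> ext_s E = ext_s E'"
        "d \<cdot> ext_\<kappa> E' = ext_\<kappa> E'' \<cdot> c" "ext_p E'' \<cdot> d = ext_p E'" "d \<cdot> ext_s E' = ext_s E''"
      using 3 unfolding f g Hom_SpEx by auto
    have "(d \<cdot> b) \<cdot> ext_\<kappa> E = ext_\<kappa> E'' \<cdot> (c \<cdot> a)"
      using assoc[OF mor(1)[OF E(1)] a(2) c(2)] assoc[OF a(1) mor(1)[OF E(2)] c(2)]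
        assoc[OF a(1) c(1) mor(1)[OF E(3)]] eq by metis
    moreover have "ext_p E'' \<cdot> (d \<cdot> b) = ext_p E"
      using assoc[OF a(2) c(2) mor(2)[OF E(3)]] eq by metis
    moreover have "(d \<cdot> b) \<cdot> ext_s E = ext_s E''"
      using assoc[OF mor(3)[OF E(1)] a(2) c(2)] eq by metis
    ultimately show ?case
      unfolding f g Cmp Hom_SpEx using E cmp[OF a(1) c(1)] cmp[OF a(2) c(2)] by blast
  next
    case (4 f a b)
    then show ?case
      using arrow[OF 4] by (auto simp: Idn Cmp Hom_SpEx idn_left)
  next
    case (5 f a b)
    then show ?case
      using arrow[OF 5] by (auto simp: Idn Cmp Hom_SpEx idn_right)
  next
    case (6 f a b g c h d)
    then show ?case
      using arrow[OF 6(1)] arrow[OF 6(2)] arrow[OF 6(3)] by (auto simp: Cmp Hom_SpEx assoc)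
  qed
qed

lemma is_functor_ker_functor:
  assumes "category C"
  shows "is_functor (SpEx C B) C ker_functor"
  unfolding is_functor_def
proof (intro conjI ballI allI)
  fix E assume "E \<in> Ob (SpEx C B)"
  then show "on_ob ker_functor E \<in> Ob C"
    using category.dom_cod[OF assms, of "ext_\<kappa> E"]
    by (auto simp: SpEx_def ker_functor_def is_split_ext_def Hom_def)
next
  fix E E' f assume "f \<in> Hom (SpEx C B) E E'"
  then show "on_ar ker_functor f \<in> Hom C (on_ob ker_functor E) (on_ob ker_functor E')"
    by (cases f) (auto simp: ker_functor_def Hom_SpEx)
next
  fix E E' E'' f g assume "f \<in> Hom (SpEx C B) E E'" "g \<in> Hom (SpEx C B) E' E''"
  then show "on_ar ker_functor (g \<cdot>\<^bsub>SpEx C B\<^esub> f) = on_ar ker_functor g \<cdot>\<^bsub>C\<^esub> on_ar ker_functor f"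
    by (cases f; cases g) (simp add: ker_functor_def SpEx_def)
qed (use assms category_SpEx[OF assms] in \<open>simp_all add: SpEx_def ker_functor_def\<close>)

end

theory Submission
  imports Defs
begin

text \<open>In a split extension over \<open>B\<close>, an element of the middle monoid affects the kernel only through the
products that contain it as a factor and lie over \<open>1\<close>.

Suppose that \<open>B\<close> is Dedekind-finite.  Then the non-units form an ideal, so elements over a non-unit never
occur in a product over \<open>1\<close>, and a cofree extension need not store any information about them.  Over the
group \<open>Units B\<close> a split extension is a semidirect product, and the right adjoint is coinduction, as for
groups: \<open>X\<close> is sent to the functions from \<open>Units B\<close> to \<open>X\<close>.  Gluing one element over each non-unit to the
semidirect product gives the cofree split extension (\<open>coinduced\<close>), which is small if
\<open>powers_small\<close> holds for \<open>B\<close>.  This is \<open>dedekind_finite_right_adjoint\<close>.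

Suppose instead that \<open>x y = 1\<close> and \<open>y x \<noteq> 1\<close> in \<open>B\<close>.  If the kernel functor were a left adjoint, it would
preserve jointly epic families (\<open>left_adjoint_jointly_epic\<close>).  Adjoin to \<open>B\<close> two letters \<open>\<lambda>\<close> and \<open>\<rho>\<close> that
are sent to \<open>1\<close>.  The extensions generated by \<open>\<lambda>\<close> and by \<open>\<rho>\<close> jointly generate the extension with both letters.  But the
word \<open>x \<lambda> \<rho> y\<close> lies over \<open>1\<close> without being a product of words over \<open>1\<close> that each contain only one of the
letters: such a factorisation \<open>(x \<lambda> b) (c \<rho> y)\<close> needs \<open>x b = b c = c y = 1\<close>, hence \<open>b = y\<close> and
\<open>c = x\<close>, contrary to \<open>y x \<noteq> 1\<close>.  So a homomorphism on the kernel is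
not determined by its restrictions to the two sub-kernels, which is a contradiction.  This argument
(\<open>no_right_adjoint_if_not_dedekind_finite\<close>) works in a truncation of the free product that is
no larger than a finite power of \<open>B\<close> times a countable set, hence small.

Every universe under consideration contains a copy of the bicyclic monoid, which is not
Dedekind-finite; therefore \<open>Mon U\<close> is not locally algebraically cartesian closed (\<open>not_LACC_Mon\<close>).\<close>

section \<open>Right adjoints and couniversal arrows\<close>

text \<open>The counit form of an adjunction: \<open>\<epsilon>\<close> is terminal among the arrows \<open>F e' \<rightarrow> x\<close>.  It lets a right
adjoint be built, or refuted, one object \<open>x\<close> at a time, without handling naturality.\<close>

definition couniversal ::
  "('o, 'm) cat \<Rightarrow> ('p, 'n) cat \<Rightarrow> ('o, 'm, 'p, 'n) cfunctor \<Rightarrow> 'p \<Rightarrow> 'o \<Rightarrow> 'n \<Rightarrow> bool" where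
  "couniversal C D F x e \<epsilon> \<longleftrightarrow> e \<in> Ob C \<and> \<epsilon> \<in> Hom D (on_ob F e) x \<and>
     (\<forall>e'\<in>Ob C. \<forall>h\<in>Hom D (on_ob F e') x. \<exists>!u. u \<in> Hom C e' e \<and> \<epsilon> \<cdot>\<^bsub>D\<^esub> on_ar F u = h)"

text \<open>The couniversal arrow corresponds to the identity of \<open>R x\<close>; by naturality, \<open>\<theta>\<close> is then inverse to
\<open>u \<mapsto> \<epsilon> \<cdot> F u\<close>.\<close>

lemma right_adjoint_couniversal:
  assumes "has_right_adjoint C D F" and x: "x \<in> Ob D"
  shows "\<exists>e \<epsilon>. couniversal C D F x e \<epsilon>"
proof -
  obtain R \<theta> where F: "is_functor C D F" and R: "is_functor D C R"
    and bij: "\<And>e x. \<lbrakk>e \<in> Ob C; x \<in> Ob D\<rbrakk> \<Longrightarrow>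
      bij_betw (\<theta> e x) (Hom D (on_ob F e) x) (Hom C e (on_ob R x))"
    and nat: "\<And>e' e x x' u f v. \<lbrakk>e' \<in> Ob C; e \<in> Ob C; x \<in> Ob D; x' \<in> Ob D;
        u \<in> Hom C e' e; f \<in> Hom D (on_ob F e) x; v \<in> Hom D x x'\<rbrakk> \<Longrightarrow>
      \<theta> e' x' (v \<cdot>\<^bsub>D\<^esub> (f \<cdot>\<^bsub>D\<^esub> on_ar F u)) = on_ar R v \<cdot>\<^bsub>C\<^esub> (\<theta> e x f \<cdot>\<^bsub>C\<^esub> u)"
    using assms(1) unfolding has_right_adjoint_def is_right_adjoint_def by metis
  interpret C: category C using F by (simp add: is_functor_def)
  interpret D: category D using F by (simp add: is_functor_def)
  let ?r = "on_ob R x"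
  have r: "?r \<in> Ob C" using R x by (simp add: is_functor_def)
  have Rid: "on_ar R (Idn D x) = Idn C ?r" using R x by (simp add: is_functor_def)
  obtain \<epsilon> where \<epsilon>: "\<epsilon> \<in> Hom D (on_ob F ?r) x" "\<theta> ?r x \<epsilon> = Idn C ?r"
    using bij[OF r x] C.idn[OF r] unfolding bij_betw_def by (metis imageE)
  have Fu: "on_ar F u \<in> Hom D (on_ob F e) (on_ob F ?r)" if "u \<in> Hom C e ?r" for e u
    using F that by (simp add: is_functor_def)
  have key: "\<theta> e x (\<epsilon> \<cdot>\<^bsub>D\<^esub> on_ar F u) = u" if "e \<in> Ob C" "u \<in> Hom C e ?r" for e u
    using nat[OF that(1) r x x that(2) \<epsilon>(1) D.idn[OF x]] that
    by (simp add: Rid \<epsilon>(2) C.idn_left[OF that(2)] D.idn_left[OF D.cmp[OF Fu[OF that(2)] \<epsilon>(1)]])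
  have "\<exists>!u. u \<in> Hom C e ?r \<and> \<epsilon> \<cdot>\<^bsub>D\<^esub> on_ar F u = h"
    if e: "e \<in> Ob C" and h: "h \<in> Hom D (on_ob F e) x" for e h
  proof (rule ex1I)
    have u: "\<theta> e x h \<in> Hom C e ?r"
      using bij_betwE[OF bij[OF e x]] h by blast
    have "\<epsilon> \<cdot>\<^bsub>D\<^esub> on_ar F (\<theta> e x h) = h"
      using inj_onD[OF bij_betw_imp_inj_on[OF bij[OF e x]] key[OF e u]]
        D.cmp[OF Fu[OF u] \<epsilon>(1)] h by blast
    then show "\<theta> e x h \<in> Hom C e ?r \<and> \<epsilon> \<cdot>\<^bsub>D\<^esub> on_ar F (\<theta> e x h) = h"
      using u by blast
    show "u = \<theta> e x h" if "u \<in> Hom C e ?r \<and> \<epsilon> \<cdot>\<^bsub>D\<^esub> on_ar F u = h" for u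
      using key[OF e, of u] that by auto
  qed
  then show ?thesis
    using r \<epsilon>(1) unfolding couniversal_def by blast
qed

text \<open>A choice of couniversal arrows \<open>\<epsilon> x : F (r x) \<rightarrow> x\<close> extends to a functor: \<open>R f\<close> is forced to be the
arrow through which \<open>f \<cdot> \<epsilon>\<close> factors, and functoriality and naturality follow from the uniqueness of
such factorisations.\<close>

lemma has_right_adjointI:
  assumes F: "is_functor C D F"
    and ex: "\<And>x. x \<in> Ob D \<Longrightarrow> \<exists>e \<epsilon>. couniversal C D F x e \<epsilon>"
  shows "has_right_adjoint C D F"
proof -
  interpret C: category C using F by (simp add: is_functor_def)
  interpret D: category D using F by (simp add: is_functor_def)
  have FH: "on_ar F u \<in> Hom D (on_ob F a) (on_ob F b)" if "u \<in> Hom C a b" for a b u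
    using F that by (simp add: is_functor_def)
  have FO: "on_ob F a \<in> Ob D" if "a \<in> Ob C" for a
    using F that by (simp add: is_functor_def)
  have Fid: "on_ar F (Idn C a) = Idn D (on_ob F a)" if "a \<in> Ob C" for a
    using F that by (simp add: is_functor_def)
  have Fcmp: "on_ar F (g \<cdot>\<^bsub>C\<^esub> f) = on_ar F g \<cdot>\<^bsub>D\<^esub> on_ar F f"
    if "f \<in> Hom C a b" "g \<in> Hom C b c" for a b c f g
    using F that by (auto simp: is_functor_def)
  have ob: "a \<in> Ob D" "b \<in> Ob D" if "f \<in> Hom D a b" for f a b
    using that D.dom_cod[of f] by (auto simp: Hom_def)
  have obC: "a \<in> Ob C" "b \<in> Ob C" if "f \<in> Hom C a b" for f a b
    using that C.dom_cod[of f] by (auto simp: Hom_def)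
  obtain r \<epsilon> where cu: "\<And>x. x \<in> Ob D \<Longrightarrow> couniversal C D F x (r x) (\<epsilon> x)"
    using ex by metis
  have r: "r x \<in> Ob C" and \<epsilon>: "\<epsilon> x \<in> Hom D (on_ob F (r x)) x" if "x \<in> Ob D" for x
    using cu[OF that] by (auto simp: couniversal_def)
  define lift where "lift e x h = (THE u. u \<in> Hom C e (r x) \<and> \<epsilon> x \<cdot>\<^bsub>D\<^esub> on_ar F u = h)" for e x h
  have lift: "lift e x h \<in> Hom C e (r x)" "\<epsilon> x \<cdot>\<^bsub>D\<^esub> on_ar F (lift e x h) = h"
    if "e \<in> Ob C" "x \<in> Ob D" "h \<in> Hom D (on_ob F e) x" for e x h
    using theI'[of "\<lambda>u. u \<in> Hom C e (r x) \<and> \<epsilon> x \<cdot>\<^bsub>D\<^esub> on_ar F u = h"] cu[OF that(2)] that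
    unfolding lift_def couniversal_def by auto
  have lift_eq: "lift e x h = u"
    if "x \<in> Ob D" "u \<in> Hom C e (r x)" "\<epsilon> x \<cdot>\<^bsub>D\<^esub> on_ar F u = h" for e x h u
  proof -
    have h: "h \<in> Hom D (on_ob F e) x"
      using D.cmp[OF FH[OF that(2)] \<epsilon>[OF that(1)]] that(3) by simp
    then have "\<exists>!u. u \<in> Hom C e (r x) \<and> \<epsilon> x \<cdot>\<^bsub>D\<^esub> on_ar F u = h"
      using cu[OF that(1)] obC[OF that(2)] by (auto simp: couniversal_def)
    then show ?thesis
      using lift[OF obC(1)[OF that(2)] that(1) h] that by blast
  qed
  define R where "R = \<lparr>on_ob = r,
    on_ar = (\<lambda>f. lift (r (Dom D f)) (Cod D f) (f \<cdot>\<^bsub>D\<^esub> \<epsilon> (Dom D f)))\<rparr>"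
  have Rob: "on_ob R = r" by (simp add: R_def)
  have R: "on_ar R f \<in> Hom C (r a) (r b)" "\<epsilon> b \<cdot>\<^bsub>D\<^esub> on_ar F (on_ar R f) = f \<cdot>\<^bsub>D\<^esub> \<epsilon> a"
    if "f \<in> Hom D a b" for f a b
  proof -
    have "on_ar R f = lift (r a) b (f \<cdot>\<^bsub>D\<^esub> \<epsilon> a)"
      using that by (simp add: R_def Hom_def)
    then show "on_ar R f \<in> Hom C (r a) (r b)" "\<epsilon> b \<cdot>\<^bsub>D\<^esub> on_ar F (on_ar R f) = f \<cdot>\<^bsub>D\<^esub> \<epsilon> a"
      using lift[OF r[OF ob(1)[OF that]] ob(2)[OF that] D.cmp[OF \<epsilon>[OF ob(1)[OF that]] that]]
      by simp_all
  qed
  have R_eq: "on_ar R f = u"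
    if "f \<in> Hom D a b" "u \<in> Hom C (r a) (r b)" "\<epsilon> b \<cdot>\<^bsub>D\<^esub> on_ar F u = f \<cdot>\<^bsub>D\<^esub> \<epsilon> a" for f a b u
    using lift_eq[OF ob(2)[OF that(1)] that(2,3)] that(1) by (simp add: R_def Hom_def)
  have R_functor: "is_functor D C R"
    unfolding is_functor_def
  proof (intro conjI ballI allI)
    show "on_ar R (Idn D a) = Idn C (on_ob R a)" if "a \<in> Ob D" for a
      unfolding Rob
      by (rule R_eq[OF D.idn[OF that] C.idn[OF r[OF that]]])
        (simp add: Fid[OF r[OF that]] D.idn_left[OF \<epsilon>[OF that]] D.idn_right[OF \<epsilon>[OF that]])
  next
    fix a b c f g assume f: "f \<in> Hom D a b" and g: "g \<in> Hom D b c"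
    note ea = \<epsilon>[OF ob(1)[OF f]] and eb = \<epsilon>[OF ob(1)[OF g]] and ec = \<epsilon>[OF ob(2)[OF g]]
    show "on_ar R (g \<cdot>\<^bsub>D\<^esub> f) = on_ar R g \<cdot>\<^bsub>C\<^esub> on_ar R f"
    proof (rule R_eq[OF D.cmp[OF f g] C.cmp[OF R(1)[OF f] R(1)[OF g]]])
      have "\<epsilon> c \<cdot>\<^bsub>D\<^esub> on_ar F (on_ar R g \<cdot>\<^bsub>C\<^esub> on_ar R f)
          = (\<epsilon> c \<cdot>\<^bsub>D\<^esub> on_ar F (on_ar R g)) \<cdot>\<^bsub>D\<^esub> on_ar F (on_ar R f)"
        using D.assoc[OF FH[OF R(1)[OF f]] FH[OF R(1)[OF g]] ec] Fcmp[OF R(1)[OF f] R(1)[OF g]]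
        by simp
      also have "\<dots> = g \<cdot>\<^bsub>D\<^esub> (\<epsilon> b \<cdot>\<^bsub>D\<^esub> on_ar F (on_ar R f))"
        using D.assoc[OF FH[OF R(1)[OF f]] eb g] R(2)[OF g] by simp
      also have "\<dots> = (g \<cdot>\<^bsub>D\<^esub> f) \<cdot>\<^bsub>D\<^esub> \<epsilon> a"
        using D.assoc[OF ea f g] R(2)[OF f] by simp
      finally show "\<epsilon> c \<cdot>\<^bsub>D\<^esub> on_ar F (on_ar R g \<cdot>\<^bsub>C\<^esub> on_ar R f) = (g \<cdot>\<^bsub>D\<^esub> f) \<cdot>\<^bsub>D\<^esub> \<epsilon> a" .
    qed
  qed (use C.category_axioms D.category_axioms r R(1) in \<open>simp_all add: Rob\<close>)
  have bij: "bij_betw (lift e x) (Hom D (on_ob F e) x) (Hom C e (r x))"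
    if e: "e \<in> Ob C" and x: "x \<in> Ob D" for e x
  proof (rule bij_betwI[where g = "\<lambda>u. \<epsilon> x \<cdot>\<^bsub>D\<^esub> on_ar F u"])
    show "lift e x \<in> Hom D (on_ob F e) x \<rightarrow> Hom C e (r x)" using lift(1)[OF e x] by blast
    show "(\<lambda>u. \<epsilon> x \<cdot>\<^bsub>D\<^esub> on_ar F u) \<in> Hom C e (r x) \<rightarrow> Hom D (on_ob F e) x"
      using D.cmp[OF FH \<epsilon>[OF x]] by blast
  qed (use lift(2)[OF e x] lift_eq[OF x] in auto)
  have nat: "lift e' x' (v \<cdot>\<^bsub>D\<^esub> (f \<cdot>\<^bsub>D\<^esub> on_ar F u)) = on_ar R v \<cdot>\<^bsub>C\<^esub> (lift e x f \<cdot>\<^bsub>C\<^esub> u)"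
    if u: "u \<in> Hom C e' e" and f: "f \<in> Hom D (on_ob F e) x" and v: "v \<in> Hom D x x'"
    for e' e x x' u f v
  proof (rule lift_eq[OF ob(2)[OF v]])
    note l = lift[OF obC(2)[OF u] ob(2)[OF f] f]
    note lu = C.cmp[OF u l(1)]
    show "on_ar R v \<cdot>\<^bsub>C\<^esub> (lift e x f \<cdot>\<^bsub>C\<^esub> u) \<in> Hom C e' (r x')"
      by (rule C.cmp[OF lu R(1)[OF v]])
    have "\<epsilon> x' \<cdot>\<^bsub>D\<^esub> on_ar F (on_ar R v \<cdot>\<^bsub>C\<^esub> (lift e x f \<cdot>\<^bsub>C\<^esub> u))
        = (\<epsilon> x' \<cdot>\<^bsub>D\<^esub> on_ar F (on_ar R v)) \<cdot>\<^bsub>D\<^esub> on_ar F (lift e x f \<cdot>\<^bsub>C\<^esub> u)"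
      using D.assoc[OF FH[OF lu] FH[OF R(1)[OF v]] \<epsilon>[OF ob(2)[OF v]]] Fcmp[OF lu R(1)[OF v]]
      by simp
    also have "\<dots> = v \<cdot>\<^bsub>D\<^esub> (\<epsilon> x \<cdot>\<^bsub>D\<^esub> on_ar F (lift e x f \<cdot>\<^bsub>C\<^esub> u))"
      using D.assoc[OF FH[OF lu] \<epsilon>[OF ob(1)[OF v]] v] R(2)[OF v] by simp
    also have "\<dots> = v \<cdot>\<^bsub>D\<^esub> (f \<cdot>\<^bsub>D\<^esub> on_ar F u)"
      using D.assoc[OF FH[OF u] FH[OF l(1)] \<epsilon>[OF ob(1)[OF v]]] Fcmp[OF u l(1)] l(2) by simp
    finally show "\<epsilon> x' \<cdot>\<^bsub>D\<^esub> on_ar F (on_ar R v \<cdot>\<^bsub>C\<^esub> (lift e x f \<cdot>\<^bsub>C\<^esub> u))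
        = v \<cdot>\<^bsub>D\<^esub> (f \<cdot>\<^bsub>D\<^esub> on_ar F u)" .
  qed
  show ?thesis
    unfolding has_right_adjoint_def is_right_adjoint_def
    using F R_functor bij nat Rob by metis
qed

text \<open>A left adjoint preserves jointly epic families, because two arrows \<open>F e \<rightarrow> x\<close> can be transposed to
arrows out of \<open>e\<close> and compared there.  This is the obstruction that rules out a right adjoint when
\<open>B\<close> is not Dedekind-finite.\<close>

lemma left_adjoint_jointly_epic:
  assumes adj: "has_right_adjoint C D F"
    and e: "e \<in> Ob C" and S: "\<And>u. u \<in> S \<Longrightarrow> u \<in> Hom C (Dom C u) e"
    and epic: "\<And>e' v w. \<lbrakk>v \<in> Hom C e e'; w \<in> Hom C e e'; \<And>u. u \<in> S \<Longrightarrow> v \<cdot>\<^bsub>C\<^esub> u = w \<cdot>\<^bsub>C\<^esub> u\<rbrakk> \<Longrightarrow> v = w"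
    and h: "h \<in> Hom D (on_ob F e) x" and k: "k \<in> Hom D (on_ob F e) x"
    and eq: "\<And>u. u \<in> S \<Longrightarrow> h \<cdot>\<^bsub>D\<^esub> on_ar F u = k \<cdot>\<^bsub>D\<^esub> on_ar F u"
  shows "h = k"
proof -
  have F: "is_functor C D F"
    using adj by (auto simp: has_right_adjoint_def is_right_adjoint_def)
  interpret C: category C using F by (simp add: is_functor_def)
  interpret D: category D using F by (simp add: is_functor_def)
  have FH: "on_ar F u \<in> Hom D (on_ob F a) (on_ob F b)" if "u \<in> Hom C a b" for a b u
    using F that by (simp add: is_functor_def)
  have Fcmp: "on_ar F (g \<cdot>\<^bsub>C\<^esub> f) = on_ar F g \<cdot>\<^bsub>D\<^esub> on_ar F f"
    if "f \<in> Hom C a b" "g \<in> Hom C b c" for a b c f g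
    using F that by (auto simp: is_functor_def)
  have "x \<in> Ob D" using h D.dom_cod[of h] by (auto simp: Hom_def)
  then obtain r \<epsilon> where cu: "couniversal C D F x r \<epsilon>"
    using right_adjoint_couniversal[OF adj] by blast
  then have \<epsilon>: "\<epsilon> \<in> Hom D (on_ob F r) x" by (simp add: couniversal_def)
  obtain v w where v: "v \<in> Hom C e r" "\<epsilon> \<cdot>\<^bsub>D\<^esub> on_ar F v = h"
    and w: "w \<in> Hom C e r" "\<epsilon> \<cdot>\<^bsub>D\<^esub> on_ar F w = k"
    using cu e h k unfolding couniversal_def by metis
  have "v = w"
  proof (rule epic[OF v(1) w(1)])
    fix u assume u: "u \<in> S"
    note uH = S[OF u]
    have "\<epsilon> \<cdot>\<^bsub>D\<^esub> on_ar F (v \<cdot>\<^bsub>C\<^esub> u) = h \<cdot>\<^bsub>D\<^esub> on_ar F u"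
      using D.assoc[OF FH[OF uH] FH[OF v(1)] \<epsilon>] Fcmp[OF uH v(1)] v(2) by simp
    moreover have "\<epsilon> \<cdot>\<^bsub>D\<^esub> on_ar F (w \<cdot>\<^bsub>C\<^esub> u) = h \<cdot>\<^bsub>D\<^esub> on_ar F u"
      using D.assoc[OF FH[OF uH] FH[OF w(1)] \<epsilon>] Fcmp[OF uH w(1)] w(2) eq[OF u] by simp
    moreover have "Dom C u \<in> Ob C" using uH C.dom_cod[of u] by (auto simp: Hom_def)
    moreover have "h \<cdot>\<^bsub>D\<^esub> on_ar F u \<in> Hom D (on_ob F (Dom C u)) x"
      by (rule D.cmp[OF FH[OF uH] h])
    ultimately show "v \<cdot>\<^bsub>C\<^esub> u = w \<cdot>\<^bsub>C\<^esub> u"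
      using cu C.cmp[OF uH v(1)] C.cmp[OF uH w(1)] unfolding couniversal_def by blast
  qed
  then show ?thesis using v w by simp
qed

section \<open>Small sets\<close>

text \<open>Smallness is needed for sets on arbitrary types, because monoids are first constructed on convenient
types of pairs or words and encoded into \<open>'u\<close> only afterwards.\<close>

definition small :: "'u set set \<Rightarrow> 'c set \<Rightarrow> bool" where
  "small U A \<longleftrightarrow> (\<exists>X\<in>U. A \<lesssim> X)"

lemma lepoll_total: "A \<lesssim> B \<or> B \<lesssim> A"
  using ordLeq_total[OF card_of_Well_order card_of_Well_order, of A B]
  by (simp add: lepoll_def card_of_ordLeq)

lemma small_lepoll: "small U B \<Longrightarrow> A \<lesssim> B \<Longrightarrow> small U A"
  unfolding small_def using lepoll_trans by blast

lemma small_member: "X \<in> U \<Longrightarrow> small U X"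
  unfolding small_def by blast

lemma small_nat: "size_universe U \<Longrightarrow> small U (A :: nat set)"
  unfolding size_universe_def small_def
  by (meson infinite_le_lepoll lepoll_trans subset_UNIV subset_imp_lepoll)

lemma small_Times:
  assumes U: "size_universe U" and A: "small U A" and B: "small U B"
  shows "small U (A \<times> B)"
proof -
  obtain X Y where X: "X \<in> U" "A \<lesssim> X" and Y: "Y \<in> U" "B \<lesssim> Y"
    using A B unfolding small_def by blast
  obtain N where N: "N \<in> U" "infinite N"
    using U unfolding size_universe_def by blast
  have larger: "\<exists>Z\<in>U. X' \<lesssim> Z \<and> Y' \<lesssim> Z" if "X' \<in> U" "Y' \<in> U" for X' Y'
    using lepoll_total[of X' Y'] lepoll_refl that by blast
  obtain V where V: "V \<in> U" "X \<lesssim> V" "Y \<lesssim> V"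
    using larger[OF X(1) Y(1)] by blast
  obtain Z where Z: "Z \<in> U" "V \<lesssim> Z" "N \<lesssim> Z"
    using larger[OF V(1) N(1)] by blast
  have inf: "infinite Z"
    using N(2) Z(3) lepoll_trans unfolding infinite_le_lepoll by blast
  have "A \<times> B \<lesssim> Z \<times> Z"
    by (intro times_lepoll_mono lepoll_trans[OF X(2) lepoll_trans[OF V(2) Z(2)]]
        lepoll_trans[OF Y(2) lepoll_trans[OF V(3) Z(2)]])
  also have "Z \<times> Z \<lesssim> Z"
    using card_of_Times_same_infinite[OF inf]
    by (simp add: eqpoll_iff_card_of_ordIso eqpoll_imp_lepoll)
  finally show ?thesis
    using Z(1) unfolding small_def by blast
qed

lemma small_encode:
  assumes "size_universe U" and "small U A"
  obtains j :: "'c \<Rightarrow> 'u" where "inj_on j A" "\<And>S. S \<subseteq> A \<Longrightarrow> j ` S \<in> U"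
proof -
  obtain X and j :: "'c \<Rightarrow> 'u" where X: "X \<in> U" and j: "inj_on j A" "j ` A \<subseteq> X"
    using assms(2) unfolding small_def lepoll_def by blast
  have "j ` S \<in> U" if "S \<subseteq> A" for S
  proof -
    have "j ` S \<lesssim> X"
      using j(2) that by (intro subset_imp_lepoll) blast
    then show ?thesis
      using assms(1) X unfolding size_universe_def by blast
  qed
  then show ?thesis using that j(1) by blast
qed

section \<open>Monoids in the category of small monoids\<close>

text \<open>Transport of structure along an encoding \<open>j\<close> of the carrier.\<close>

definition copy :: "('c \<Rightarrow> 'u) \<Rightarrow> ('c, 'z) monoid_scheme \<Rightarrow> 'u monoid" where
  "copy j M = \<lparr>carrier = j ` carrier M,
     mult = (\<lambda>a b. j (inv_into (carrier M) j a \<otimes>\<^bsub>M\<^esub> inv_into (carrier M) j b)),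
     one = j \<one>\<^bsub>M\<^esub>\<rparr>"

lemma carrier_copy [simp]: "carrier (copy j M) = j ` carrier M"
  and one_copy [simp]: "\<one>\<^bsub>copy j M\<^esub> = j \<one>\<^bsub>M\<^esub>"
  by (simp_all add: copy_def)

lemma mult_copy:
  "\<lbrakk>inj_on j (carrier M); a \<in> carrier M; b \<in> carrier M\<rbrakk> \<Longrightarrow> j a \<otimes>\<^bsub>copy j M\<^esub> j b = j (a \<otimes>\<^bsub>M\<^esub> b)"
  by (simp add: copy_def)

lemma monoid_copy:
  assumes "monoid M" and j: "inj_on j (carrier M)"
  shows "monoid (copy j M)"
proof -
  interpret monoid M by (rule assms)
  show ?thesis
    by (rule monoidI) (auto simp: mult_copy[OF j] m_assoc)
qed

text \<open>Monoid homomorphisms in the usual sense; membership in \<^const>\<open>hom\<close> alone does not force units to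
be preserved.\<close>

definition mhom :: "('a, 'x) monoid_scheme \<Rightarrow> ('b, 'y) monoid_scheme \<Rightarrow> ('a \<Rightarrow> 'b) set" where
  "mhom M N = {f \<in> hom M N. f \<one>\<^bsub>M\<^esub> = \<one>\<^bsub>N\<^esub>}"

lemma mhomI:
  assumes "\<And>a. a \<in> carrier M \<Longrightarrow> f a \<in> carrier N"
    and "\<And>a b. \<lbrakk>a \<in> carrier M; b \<in> carrier M\<rbrakk> \<Longrightarrow> f (a \<otimes>\<^bsub>M\<^esub> b) = f a \<otimes>\<^bsub>N\<^esub> f b"
    and "f \<one>\<^bsub>M\<^esub> = \<one>\<^bsub>N\<^esub>"
  shows "f \<in> mhom M N"
  using assms by (auto simp: mhom_def hom_def)

lemma mhomD:
  assumes "f \<in> mhom M N"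
  shows "a \<in> carrier M \<Longrightarrow> f a \<in> carrier N"
    and "\<lbrakk>a \<in> carrier M; b \<in> carrier M\<rbrakk> \<Longrightarrow> f (a \<otimes>\<^bsub>M\<^esub> b) = f a \<otimes>\<^bsub>N\<^esub> f b"
    and "f \<one>\<^bsub>M\<^esub> = \<one>\<^bsub>N\<^esub>"
  using assms by (auto simp: mhom_def hom_def)

lemma mhom_comp: "f \<in> mhom M N \<Longrightarrow> g \<in> mhom N P \<Longrightarrow> (\<lambda>x. g (f x)) \<in> mhom M P"
  by (auto simp: mhom_def hom_def Pi_iff)

text \<open>Every arrow of \<open>Mon U\<close> has this form, so that all reasoning about arrows can use ordinary functions
whose values outside the carrier are irrelevant.\<close>

definition arrow :: "'u monoid \<Rightarrow> ('u \<Rightarrow> 'u) \<Rightarrow> 'u monoid \<Rightarrow> 'u mon_arrow" where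
  "arrow M f N = (M, restrict f (carrier M), N)"

lemma Ob_Mon: "M \<in> Ob (Mon U) \<longleftrightarrow> monoid M \<and> carrier M \<in> U"
  by (simp add: Mon_def)

lemma arrow_in_Hom:
  "\<lbrakk>M \<in> Ob (Mon U); N \<in> Ob (Mon U); f \<in> mhom M N\<rbrakk> \<Longrightarrow> arrow M f N \<in> Hom (Mon U) M N"
  by (auto simp: Mon_def Hom_def arrow_def mhom_def hom_def monoid.m_closed monoid.one_closed)

lemma Hom_MonE:
  assumes "F \<in> Hom (Mon U) M N"
  obtains f where "F = arrow M f N" "f \<in> mhom M N" "M \<in> Ob (Mon U)" "N \<in> Ob (Mon U)"
proof -
  obtain f where f: "F = (M, f, N)"
    using assms by (cases F) (auto simp: Hom_def Mon_def)
  have "F = arrow M f N"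
    using assms by (auto simp: f Hom_def Mon_def arrow_def extensional_restrict)
  moreover have "f \<in> mhom M N" "M \<in> Ob (Mon U)" "N \<in> Ob (Mon U)"
    using assms by (auto simp: f Hom_def Mon_def mhom_def)
  ultimately show ?thesis using that by blast
qed

lemma arrow_eq_iff: "arrow M f N = arrow M' g N' \<longleftrightarrow> M = M' \<and> N = N' \<and> (\<forall>a\<in>carrier M. f a = g a)"
  by (auto simp: arrow_def restrict_def fun_eq_iff)

lemma Cmp_arrow:
  "f \<in> mhom M N \<Longrightarrow> arrow N g P \<cdot>\<^bsub>Mon U\<^esub> arrow M f N = arrow M (\<lambda>x. g (f x)) P"
  by (auto simp: arrow_def Mon_def compose_def restrict_def fun_eq_iff mhomD)

lemma Idn_Mon: "Idn (Mon U) M = arrow M (\<lambda>x. x) M"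
  by (auto simp: Mon_def arrow_def restrict_def)

lemma Dom_arrow [simp]: "Dom (Mon U) (arrow M f N) = M"
  and Cod_arrow [simp]: "Cod (Mon U) (arrow M f N) = N"
  by (simp_all add: Mon_def arrow_def)

text \<open>A zero object is trivial since its identity and its constant endomorphism coincide.\<close>

lemma zero_object_Mon:
  assumes "zero_object (Mon U) Z" and "z \<in> carrier Z"
  shows "z = \<one>\<^bsub>Z\<^esub>"
proof -
  have Z: "Z \<in> Ob (Mon U)" and uniq: "\<exists>!f. f \<in> Hom (Mon U) Z Z"
    using assms(1) by (auto simp: zero_object_def)
  interpret Z: monoid Z using Z by (simp add: Ob_Mon)
  have "arrow Z (\<lambda>x. x) Z \<in> Hom (Mon U) Z Z" "arrow Z (\<lambda>x. \<one>\<^bsub>Z\<^esub>) Z \<in> Hom (Mon U) Z Z"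
    by (auto intro!: arrow_in_Hom Z mhomI)
  then have "arrow Z (\<lambda>x. x) Z = arrow Z (\<lambda>x. \<one>\<^bsub>Z\<^esub>) Z"
    using uniq by blast
  then show ?thesis using assms(2) by (simp add: arrow_eq_iff)
qed

lemma zero_arrow_Mon_iff:
  assumes U: "size_universe U" and ob: "M \<in> Ob (Mon U)" "N \<in> Ob (Mon U)" and f: "f \<in> mhom M N"
  shows "zero_arrow (Mon U) (arrow M f N) \<longleftrightarrow> (\<forall>a\<in>carrier M. f a = \<one>\<^bsub>N\<^esub>)"
proof
  assume "zero_arrow (Mon U) (arrow M f N)"
  then obtain Z g h where Z: "zero_object (Mon U) Z" and g: "g \<in> Hom (Mon U) M Z"
    and h: "h \<in> Hom (Mon U) Z N" and eq: "arrow M f N = h \<cdot>\<^bsub>Mon U\<^esub> g"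
    by (auto simp: zero_arrow_def)
  obtain g' where g': "g = arrow M g' Z" "g' \<in> mhom M Z" using g by (rule Hom_MonE)
  obtain h' where h': "h = arrow Z h' N" "h' \<in> mhom Z N" using h by (rule Hom_MonE)
  have fa: "f a = h' (g' a)" if "a \<in> carrier M" for a
    using eq that g'(2) by (simp add: g'(1) h'(1) Cmp_arrow arrow_eq_iff)
  show "\<forall>a\<in>carrier M. f a = \<one>\<^bsub>N\<^esub>"
  proof
    fix a assume a: "a \<in> carrier M"
    have "g' a = \<one>\<^bsub>Z\<^esub>" by (rule zero_object_Mon[OF Z mhomD(1)[OF g'(2) a]])
    then show "f a = \<one>\<^bsub>N\<^esub>" using fa[OF a] mhomD(3)[OF h'(2)] by simp
  qed
next
  assume one: "\<forall>a\<in>carrier M. f a = \<one>\<^bsub>N\<^esub>"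
  have "\<exists>Z. zero_object (Mon U) Z"
    using pointed_Mon[OF U] unfolding pointed_category_def by (rule conjunct2)
  then obtain Z where Z: "zero_object (Mon U) Z" ..
  have "\<exists>!g. g \<in> Hom (Mon U) M Z" "\<exists>!h. h \<in> Hom (Mon U) Z N"
    using Z ob by (simp_all add: zero_object_def)
  then obtain g h where g: "g \<in> Hom (Mon U) M Z" and h: "h \<in> Hom (Mon U) Z N"
    by (elim ex1E)
  obtain g' where g': "g = arrow M g' Z" "g' \<in> mhom M Z" using g by (rule Hom_MonE)
  obtain h' where h': "h = arrow Z h' N" "h' \<in> mhom Z N" using h by (rule Hom_MonE)
  have "h' (g' a) = \<one>\<^bsub>N\<^esub>" if a: "a \<in> carrier M" for a
    using zero_object_Mon[OF Z mhomD(1)[OF g'(2) a]] mhomD(3)[OF h'(2)] by simp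
  then have "arrow M f N = h \<cdot>\<^bsub>Mon U\<^esub> g"
    using one g'(2) by (simp add: g'(1) h'(1) Cmp_arrow arrow_eq_iff)
  then show "zero_arrow (Mon U) (arrow M f N)"
    unfolding zero_arrow_def Dom_arrow Cod_arrow using Z g h by blast
qed

section \<open>Split extensions of monoids\<close>

definition ker_monoid :: "'u monoid \<Rightarrow> 'u monoid \<Rightarrow> ('u \<Rightarrow> 'u) \<Rightarrow> 'u monoid" where
  "ker_monoid G B p = G\<lparr>carrier := {g \<in> carrier G. p g = \<one>\<^bsub>B\<^esub>}\<rparr>"

lemma ker_monoid_simps [simp]:
  "carrier (ker_monoid G B p) = {g \<in> carrier G. p g = \<one>\<^bsub>B\<^esub>}"
  "a \<otimes>\<^bsub>ker_monoid G B p\<^esub> b = a \<otimes>\<^bsub>G\<^esub> b" "\<one>\<^bsub>ker_monoid G B p\<^esub> = \<one>\<^bsub>G\<^esub>"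
  by (simp_all add: ker_monoid_def)

lemma size_universe_subset: "\<lbrakk>size_universe U; X \<in> U; Y \<subseteq> X\<rbrakk> \<Longrightarrow> Y \<in> U"
  unfolding size_universe_def using subset_imp_lepoll by blast

lemma ker_monoid_Ob:
  assumes U: "size_universe U" and G: "G \<in> Ob (Mon U)" and B: "B \<in> Ob (Mon U)"
    and p: "p \<in> mhom G B"
  shows "ker_monoid G B p \<in> Ob (Mon U)"
proof -
  interpret G: monoid G using G by (simp add: Ob_Mon)
  interpret B: monoid B using B by (simp add: Ob_Mon)
  have "monoid (ker_monoid G B p)"
    by (rule monoidI) (auto simp: mhomD[OF p] G.m_assoc)
  moreover have "carrier (ker_monoid G B p) \<in> U"
    using size_universe_subset[OF U] G by (auto simp: Ob_Mon)
  ultimately show ?thesis by (simp add: Ob_Mon)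
qed

inductive_set ext_span :: "'u monoid \<Rightarrow> 'u monoid \<Rightarrow> ('u \<Rightarrow> 'u) \<Rightarrow> ('u \<Rightarrow> 'u) \<Rightarrow> 'u set"
  for G B p s where
    ker: "\<lbrakk>g \<in> carrier G; p g = \<one>\<^bsub>B\<^esub>\<rbrakk> \<Longrightarrow> g \<in> ext_span G B p s"
  | sec: "b \<in> carrier B \<Longrightarrow> s b \<in> ext_span G B p s"
  | mult: "\<lbrakk>g \<in> ext_span G B p s; h \<in> ext_span G B p s\<rbrakk> \<Longrightarrow> g \<otimes>\<^bsub>G\<^esub> h \<in> ext_span G B p s"

definition split_ext_of ::
  "'u monoid \<Rightarrow> 'u monoid \<Rightarrow> ('u \<Rightarrow> 'u) \<Rightarrow> ('u \<Rightarrow> 'u) \<Rightarrow> ('u monoid, 'u mon_arrow) split_ext" where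
  "split_ext_of G B p s = \<lparr>ext_A = ker_monoid G B p, ext_G = G,
     ext_\<kappa> = arrow (ker_monoid G B p) (\<lambda>x. x) G, ext_p = arrow G p B, ext_s = arrow B s G\<rparr>"

text \<open>If kernel and section generate \<open>G\<close>, then \<open>p\<close> is a cokernel of the kernel inclusion: a homomorphism
\<open>f\<close> that is trivial on the kernel satisfies \<open>f g = f (s (p g))\<close> on the generators, hence everywhere,
so it factors through \<open>p\<close> as \<open>f \<circ> s\<close>.\<close>

lemma is_split_ext_of:
  assumes U: "size_universe U" and G: "G \<in> Ob (Mon U)" and B: "B \<in> Ob (Mon U)"
    and p: "p \<in> mhom G B" and s: "s \<in> mhom B G"
    and ps: "\<And>b. b \<in> carrier B \<Longrightarrow> p (s b) = b"
    and span: "carrier G \<subseteq> ext_span G B p s"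
  shows "is_split_ext (Mon U) B (split_ext_of G B p s)"
proof -
  let ?K = "ker_monoid G B p"
  let ?k = "arrow ?K (\<lambda>x. x) G" and ?p = "arrow G p B" and ?s = "arrow B s G"
  interpret G: monoid G using G by (simp add: Ob_Mon)
  interpret B: monoid B using B by (simp add: Ob_Mon)
  note K = ker_monoid_Ob[OF U G B p]
  have i: "(\<lambda>x. x) \<in> mhom ?K G" by (rule mhomI) auto
  have Hom: "?k \<in> Hom (Mon U) ?K G" "?p \<in> Hom (Mon U) G B" "?s \<in> Hom (Mon U) B G"
    using arrow_in_Hom K G B i p s by blast+
  then have Ar: "?k \<in> Ar (Mon U)" "?p \<in> Ar (Mon U)" by (auto simp: Hom_def)
  have zero: "zero_arrow (Mon U) (?p \<cdot>\<^bsub>Mon U\<^esub> ?k)"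
    using i mhom_comp[OF i p] by (simp add: Cmp_arrow zero_arrow_Mon_iff[OF U K B])
  have "is_kernel (Mon U) ?k ?p"
    unfolding is_kernel_def
  proof (intro conjI allI ballI impI)
    fix X F assume F: "F \<in> Hom (Mon U) X (Dom (Mon U) ?p)"
      and z: "zero_arrow (Mon U) (?p \<cdot>\<^bsub>Mon U\<^esub> F)"
    obtain f where f: "F = arrow X f G" "f \<in> mhom X G" and X: "X \<in> Ob (Mon U)"
      using F by (auto elim: Hom_MonE)
    have pf: "p (f a) = \<one>\<^bsub>B\<^esub>" if "a \<in> carrier X" for a
      using z that f(2) mhom_comp[OF f(2) p]
      by (simp add: f(1) Cmp_arrow zero_arrow_Mon_iff[OF U X B])
    have fK: "f \<in> mhom X ?K" by (rule mhomI) (auto simp: mhomD[OF f(2)] pf)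
    show "\<exists>!u. u \<in> Hom (Mon U) X (Dom (Mon U) ?k) \<and> ?k \<cdot>\<^bsub>Mon U\<^esub> u = F"
    proof (rule ex1I)
      show "arrow X f ?K \<in> Hom (Mon U) X (Dom (Mon U) ?k) \<and> ?k \<cdot>\<^bsub>Mon U\<^esub> arrow X f ?K = F"
        using arrow_in_Hom[OF X K fK] fK by (simp add: Cmp_arrow f(1))
    next
      fix u assume u: "u \<in> Hom (Mon U) X (Dom (Mon U) ?k) \<and> ?k \<cdot>\<^bsub>Mon U\<^esub> u = F"
      then obtain v where v: "u = arrow X v ?K" "v \<in> mhom X ?K"
        by (auto elim: Hom_MonE)
      then show "u = arrow X f ?K"
        using u v(2) by (simp add: Cmp_arrow f(1) arrow_eq_iff)
    qed
  qed (use Ar zero in simp_all)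
  moreover have "is_cokernel (Mon U) ?p ?k"
    unfolding is_cokernel_def
  proof (intro conjI allI ballI impI)
    fix X F assume F: "F \<in> Hom (Mon U) (Cod (Mon U) ?k) X"
      and z: "zero_arrow (Mon U) (F \<cdot>\<^bsub>Mon U\<^esub> ?k)"
    obtain f where f: "F = arrow G f X" "f \<in> mhom G X" and X: "X \<in> Ob (Mon U)"
      using F by (auto elim: Hom_MonE)
    interpret X: monoid X using X by (simp add: Ob_Mon)
    have fK: "f g = \<one>\<^bsub>X\<^esub>" if "g \<in> carrier G" "p g = \<one>\<^bsub>B\<^esub>" for g
      using z that i mhom_comp[OF i f(2)]
      by (simp add: f(1) Cmp_arrow zero_arrow_Mon_iff[OF U K X])
    have "g \<in> carrier G \<and> f (s (p g)) = f g" if "g \<in> ext_span G B p s" for g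
      using that
    proof induction
      case (ker g)
      then show ?case using fK mhomD(3)[OF s] mhomD(3)[OF f(2)] by simp
    next
      case (sec b)
      then show ?case using ps mhomD(1)[OF s] by simp
    next
      case (mult g h)
      then show ?case by (simp add: mhomD[OF p] mhomD[OF s] mhomD[OF f(2)])
    qed
    then have fsp: "f (s (p g)) = f g" if "g \<in> carrier G" for g
      using span that by blast
    have fs: "(\<lambda>b. f (s b)) \<in> mhom B X" by (rule mhom_comp[OF s f(2)])
    show "\<exists>!u. u \<in> Hom (Mon U) (Cod (Mon U) ?p) X \<and> u \<cdot>\<^bsub>Mon U\<^esub> ?p = F"
    proof (rule ex1I)
      show "arrow B (\<lambda>b. f (s b)) X \<in> Hom (Mon U) (Cod (Mon U) ?p) X \<and>
          arrow B (\<lambda>b. f (s b)) X \<cdot>\<^bsub>Mon U\<^esub> ?p = F"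
        using arrow_in_Hom[OF B X fs] p fsp by (simp add: Cmp_arrow f(1) arrow_eq_iff)
    next
      fix u assume u: "u \<in> Hom (Mon U) (Cod (Mon U) ?p) X \<and> u \<cdot>\<^bsub>Mon U\<^esub> ?p = F"
      then obtain v where v: "u = arrow B v X" "v \<in> mhom B X"
        by (auto elim: Hom_MonE)
      have "v (p g) = f g" if "g \<in> carrier G" for g
        using u that p by (simp add: v(1) Cmp_arrow f(1) arrow_eq_iff)
      then have "v b = f (s b)" if "b \<in> carrier B" for b
        using that ps mhomD(1)[OF s that] by metis
      then show "u = arrow B (\<lambda>b. f (s b)) X"
        by (simp add: v(1) arrow_eq_iff)
    qed
  qed (use Ar zero in simp_all)
  moreover have "?p \<cdot>\<^bsub>Mon U\<^esub> ?s = Idn (Mon U) B"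
    using s ps by (simp add: Cmp_arrow Idn_Mon arrow_eq_iff)
  ultimately show ?thesis
    using Hom by (simp add: is_split_ext_def split_ext_of_def)
qed

text \<open>The universal property of the kernel, applied to the inclusion of the set-theoretic kernel of \<open>p\<close>,
provides a homomorphism \<open>r\<close> inverse to \<open>\<kappa>\<close>.  Thus \<open>\<kappa>\<close> is injective with image exactly the fibre of \<open>p\<close>
over the unit.\<close>

lemma split_ext_MonE:
  assumes U: "size_universe U" and E: "is_split_ext (Mon U) B E"
  obtains A G k p s r where
    "E = \<lparr>ext_A = A, ext_G = G, ext_\<kappa> = arrow A k G, ext_p = arrow G p B, ext_s = arrow B s G\<rparr>"
    "A \<in> Ob (Mon U)" "G \<in> Ob (Mon U)" "B \<in> Ob (Mon U)"
    "k \<in> mhom A G" "p \<in> mhom G B" "s \<in> mhom B G"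
    "\<And>b. b \<in> carrier B \<Longrightarrow> p (s b) = b" "\<And>a. a \<in> carrier A \<Longrightarrow> p (k a) = \<one>\<^bsub>B\<^esub>"
    "r \<in> mhom (ker_monoid G B p) A" "\<And>a. a \<in> carrier A \<Longrightarrow> r (k a) = a"
    "\<And>g. \<lbrakk>g \<in> carrier G; p g = \<one>\<^bsub>B\<^esub>\<rbrakk> \<Longrightarrow> k (r g) = g"
proof -
  let ?A = "ext_A E" and ?G = "ext_G E"
  have H: "ext_\<kappa> E \<in> Hom (Mon U) ?A ?G" "ext_p E \<in> Hom (Mon U) ?G B" "ext_s E \<in> Hom (Mon U) B ?G"
    and ker: "is_kernel (Mon U) (ext_\<kappa> E) (ext_p E)"
    and ps: "ext_p E \<cdot>\<^bsub>Mon U\<^esub> ext_s E = Idn (Mon U) B"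
    using E by (auto simp: is_split_ext_def)
  obtain k where k: "ext_\<kappa> E = arrow ?A k ?G" "k \<in> mhom ?A ?G"
    and A: "?A \<in> Ob (Mon U)" and G: "?G \<in> Ob (Mon U)"
    using H(1) by (rule Hom_MonE)
  obtain p where p: "ext_p E = arrow ?G p B" "p \<in> mhom ?G B" and B: "B \<in> Ob (Mon U)"
    using H(2) by (rule Hom_MonE)
  obtain s where s: "ext_s E = arrow B s ?G" "s \<in> mhom B ?G"
    using H(3) by (rule Hom_MonE)
  let ?K = "ker_monoid ?G B p"
  note K = ker_monoid_Ob[OF U G B p(2)]
  have univ: "\<exists>!u. u \<in> Hom (Mon U) X ?A \<and> arrow ?A k ?G \<cdot>\<^bsub>Mon U\<^esub> u = F"
    if "F \<in> Hom (Mon U) X ?G" "zero_arrow (Mon U) (arrow ?G p B \<cdot>\<^bsub>Mon U\<^esub> F)" for X F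
    using ker that unfolding is_kernel_def k(1) p(1) by simp
  have pk0: "zero_arrow (Mon U) (arrow ?G p B \<cdot>\<^bsub>Mon U\<^esub> arrow ?A k ?G)"
    using ker unfolding is_kernel_def k(1) p(1) by simp
  then have pk: "\<forall>a\<in>carrier ?A. p (k a) = \<one>\<^bsub>B\<^esub>"
    using k(2) mhom_comp[OF k(2) p(2)]
    by (simp add: Cmp_arrow zero_arrow_Mon_iff[OF U A B])
  have psb: "\<forall>b\<in>carrier B. p (s b) = b"
    using ps s(2) by (simp add: p(1) s(1) Cmp_arrow Idn_Mon arrow_eq_iff)
  have i: "(\<lambda>x. x) \<in> mhom ?K ?G" by (rule mhomI) auto
  have "zero_arrow (Mon U) (arrow ?G p B \<cdot>\<^bsub>Mon U\<^esub> arrow ?K (\<lambda>x. x) ?G)"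
    using i mhom_comp[OF i p(2)] by (simp add: Cmp_arrow zero_arrow_Mon_iff[OF U K B])
  from univ[OF arrow_in_Hom[OF K G i] this]
  obtain u where u: "u \<in> Hom (Mon U) ?K ?A"
    and ku: "arrow ?A k ?G \<cdot>\<^bsub>Mon U\<^esub> u = arrow ?K (\<lambda>x. x) ?G"
    by blast
  obtain r where r: "u = arrow ?K r ?A" "r \<in> mhom ?K ?A" using u by (rule Hom_MonE)
  have kr: "\<forall>g\<in>carrier ?G. p g = \<one>\<^bsub>B\<^esub> \<longrightarrow> k (r g) = g"
    using ku r(2) by (simp add: r(1) Cmp_arrow arrow_eq_iff)
  have kK: "k \<in> mhom ?A ?K"
    by (rule mhomI) (use pk in \<open>auto simp: mhomD[OF k(2)]\<close>)
  have id: "(\<lambda>x. x) \<in> mhom ?A ?A" by (rule mhomI) auto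
  have "arrow ?A (\<lambda>a. r (k a)) ?A \<in> Hom (Mon U) ?A ?A" "arrow ?A (\<lambda>a. a) ?A \<in> Hom (Mon U) ?A ?A"
    using arrow_in_Hom[OF A A] mhom_comp[OF kK r(2)] id by blast+
  moreover have "arrow ?A k ?G \<cdot>\<^bsub>Mon U\<^esub> arrow ?A (\<lambda>a. r (k a)) ?A = arrow ?A k ?G"
    using kr pk mhomD(1)[OF k(2)] mhom_comp[OF kK r(2)]
    by (simp add: Cmp_arrow arrow_eq_iff)
  moreover have "arrow ?A k ?G \<cdot>\<^bsub>Mon U\<^esub> arrow ?A (\<lambda>a. a) ?A = arrow ?A k ?G"
    using id by (simp add: Cmp_arrow)
  ultimately have "arrow ?A (\<lambda>a. r (k a)) ?A = arrow ?A (\<lambda>a. a) ?A"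
    using univ[OF arrow_in_Hom[OF A G k(2)] pk0] by blast
  then have rk: "\<forall>a\<in>carrier ?A. r (k a) = a" by (simp add: arrow_eq_iff)
  have "E = \<lparr>ext_A = ?A, ext_G = ?G, ext_\<kappa> = arrow ?A k ?G, ext_p = arrow ?G p B,
      ext_s = arrow B s ?G\<rparr>"
    by (simp add: k(1)[symmetric] p(1)[symmetric] s(1)[symmetric])
  then show ?thesis
    by (rule that) (use A G B k(2) p(2) s(2) psb pk r(2) rk kr in auto)
qed

text \<open>An arrow of split extensions is determined by its action on the middle monoid, because \<open>\<kappa>'\<close> is
injective.\<close>

lemma SpEx_arrow_eqI:
  assumes U: "size_universe U"
    and v: "(E, vA, vG, E') \<in> Hom (SpEx (Mon U) B) E E'" and w: "(E, wA, wG, E') \<in> Hom (SpEx (Mon U) B) E E'"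
    and eq: "vG = wG"
  shows "vA = wA"
proof -
  have E': "is_split_ext (Mon U) B E'"
    and vA: "vA \<in> Hom (Mon U) (ext_A E) (ext_A E')" and wA: "wA \<in> Hom (Mon U) (ext_A E) (ext_A E')"
    and sq: "ext_\<kappa> E' \<cdot>\<^bsub>Mon U\<^esub> vA = ext_\<kappa> E' \<cdot>\<^bsub>Mon U\<^esub> wA"
    using v w eq by (auto simp: Hom_SpEx)
  obtain A G k p s r where E'_eq: "E' = \<lparr>ext_A = A, ext_G = G, ext_\<kappa> = arrow A k G, ext_p = arrow G p B, ext_s = arrow B s G\<rparr>"
    and rk: "\<And>a. a \<in> carrier A \<Longrightarrow> r (k a) = a"
    by (rule split_ext_MonE[OF U E']) (rule that)
  obtain f g where f: "vA = arrow (ext_A E) f A" "f \<in> mhom (ext_A E) A"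
    and g: "wA = arrow (ext_A E) g A" "g \<in> mhom (ext_A E) A"
    using vA wA by (auto simp: E'_eq elim!: Hom_MonE)
  have "k (f a) = k (g a)" if "a \<in> carrier (ext_A E)" for a
    using sq that f(2) g(2)
    by (simp add: f(1) g(1) E'_eq Cmp_arrow arrow_eq_iff)
  then have "f a = g a" if "a \<in> carrier (ext_A E)" for a
    using rk mhomD(1)[OF f(2) that] mhomD(1)[OF g(2) that] that by metis
  then show ?thesis by (simp add: f(1) g(1) arrow_eq_iff)
qed

lemma SpEx_arrow_into_split_ext_of:
  assumes E: "is_split_ext (Mon U) B E" and E': "is_split_ext (Mon U) B (split_ext_of H B q t)"
    and E_eq: "E = \<lparr>ext_A = A, ext_G = G, ext_\<kappa> = arrow A k G, ext_p = arrow G p B, ext_s = arrow B s G\<rparr>"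
    and ob: "A \<in> Ob (Mon U)" "G \<in> Ob (Mon U)" "ker_monoid H B q \<in> Ob (Mon U)" "H \<in> Ob (Mon U)"
    and k: "k \<in> mhom A G" and p: "p \<in> mhom G B" and s: "s \<in> mhom B G"
    and pk: "\<And>a. a \<in> carrier A \<Longrightarrow> p (k a) = \<one>\<^bsub>B\<^esub>"
    and \<phi>: "\<phi> \<in> mhom G H" and q\<phi>: "\<And>g. g \<in> carrier G \<Longrightarrow> q (\<phi> g) = p g"
    and \<phi>s: "\<And>b. b \<in> carrier B \<Longrightarrow> \<phi> (s b) = t b"
  shows "(E, arrow A (\<lambda>a. \<phi> (k a)) (ker_monoid H B q), arrow G \<phi> H, split_ext_of H B q t)
    \<in> Hom (SpEx (Mon U) B) E (split_ext_of H B q t)"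
proof -
  have \<phi>k: "(\<lambda>a. \<phi> (k a)) \<in> mhom A (ker_monoid H B q)"
    by (rule mhomI) (simp_all add: mhomD[OF k] mhomD[OF \<phi>] q\<phi> pk)
  have i: "(\<lambda>x. x) \<in> mhom (ker_monoid H B q) H" by (rule mhomI) auto
  show ?thesis
    unfolding Hom_SpEx
    using E E' arrow_in_Hom[OF ob(1,3) \<phi>k] arrow_in_Hom[OF ob(2,4) \<phi>] \<phi> \<phi>k i k s q\<phi> \<phi>s
    by (simp add: E_eq split_ext_of_def Cmp_arrow arrow_eq_iff)
qed

section \<open>The right adjoint over a Dedekind-finite monoid\<close>

text \<open>The form in which Dedekind-finiteness is used: the non-units are a two-sided ideal.
If \<open>z\<close> is the inverse of \<open>b b'\<close>, then \<open>b' z\<close> is a right inverse of \<open>b\<close>, and \<open>z b\<close> a left inverse of \<open>b'\<close>;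
both are two-sided by assumption.\<close>

lemma dedekind_finite_Units:
  fixes B (structure)
  assumes "monoid B" and df: "dedekind_finite B"
    and b: "b \<in> carrier B" "b' \<in> carrier B" and u: "b \<otimes>\<^bsub>B\<^esub> b' \<in> Units B"
  shows "b \<in> Units B" "b' \<in> Units B"
proof -
  interpret monoid B by (rule assms)
  let ?z = "inv (b \<otimes> b')"
  have z: "?z \<in> carrier B" using u by simp
  have "b \<otimes> (b' \<otimes> ?z) = \<one>" using Units_r_inv[OF u] b z by (simp add: m_assoc)
  moreover from this have "(b' \<otimes> ?z) \<otimes> b = \<one>"
    using df b z unfolding dedekind_finite_def by blast
  ultimately show "b \<in> Units B" using b z unfolding Units_def by blast
  have "(?z \<otimes> b) \<otimes> b' = \<one>" using Units_l_inv[OF u] b z by (simp add: m_assoc)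
  moreover from this have "b' \<otimes> (?z \<otimes> b) = \<one>"
    using df b z unfolding dedekind_finite_def by blast
  ultimately show "b' \<in> Units B" using b z unfolding Units_def by blast
qed

text \<open>The index set of the functions over \<open>b\<close>.  It is empty if \<open>b\<close> is a non-unit, so that exactly one
extensional function lies over such a \<open>b\<close>.\<close>

definition fibre_index :: "('b, 'y) monoid_scheme \<Rightarrow> 'b \<Rightarrow> 'b set" where
  "fibre_index B b = (if b \<in> Units B then Units B else {})"

text \<open>The middle monoid of the cofree split extension on \<open>X\<close>.  Over the group of units this is the
wreath-like product \<open>X\<^sup>G \<rtimes> G\<close> with \<open>G = Units B\<close>, where \<open>G\<close> acts on functions by translation; over each
non-unit of \<open>B\<close> there is a single element.\<close>

definition coinduced :: "('b, 'y) monoid_scheme \<Rightarrow> ('x, 'z) monoid_scheme \<Rightarrow> ('b \<times> ('b \<Rightarrow> 'x)) monoid" where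
  "coinduced B X = \<lparr>
     carrier = (SIGMA b : carrier B. fibre_index B b \<rightarrow>\<^sub>E carrier X),
     mult = (\<lambda>(b, f) (b', f'). (b \<otimes>\<^bsub>B\<^esub> b',
       \<lambda>c\<in>fibre_index B (b \<otimes>\<^bsub>B\<^esub> b'). f c \<otimes>\<^bsub>X\<^esub> f' (c \<otimes>\<^bsub>B\<^esub> b))),
     one = (\<one>\<^bsub>B\<^esub>, \<lambda>c\<in>fibre_index B \<one>\<^bsub>B\<^esub>. \<one>\<^bsub>X\<^esub>)\<rparr>"

definition coinduced_section :: "('b, 'y) monoid_scheme \<Rightarrow> ('x, 'z) monoid_scheme \<Rightarrow> 'b \<Rightarrow> 'b \<times> ('b \<Rightarrow> 'x)" where
  "coinduced_section B X b = (b, \<lambda>c\<in>fibre_index B b. \<one>\<^bsub>X\<^esub>)"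

text \<open>An element \<open>(b, f)\<close> is determined by \<open>b\<close> and the extension of \<open>f\<close> by \<open>1\<close> to a function on all of \<open>B\<close>.\<close>

lemma small_coinduced:
  assumes U: "size_universe U" and B: "monoid B" "small U (carrier B)"
    and pow: "powers_small U (carrier B)" and X: "monoid X" "carrier X \<in> U"
  shows "small U (carrier (coinduced B X))"
proof -
  interpret B: monoid B by (rule B)
  interpret X: monoid X by (rule X)
  define F where "F = (\<lambda>(b, f). (b, \<lambda>c\<in>carrier B. if c \<in> fibre_index B b then f c else \<one>\<^bsub>X\<^esub>))"
  have sub: "fibre_index B b \<subseteq> carrier B" for b
    by (auto simp: fibre_index_def)
  have "inj_on F (carrier (coinduced B X))"
  proof (rule inj_onI)
    fix z z' assume z: "z \<in> carrier (coinduced B X)" "z' \<in> carrier (coinduced B X)" and eq: "F z = F z'"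
    obtain b f b' f' where zz: "z = (b, f)" "z' = (b', f')" by (cases z; cases z')
    have bb: "b' = b" and ff: "\<And>c. c \<in> fibre_index B b \<Longrightarrow> f c = f' c"
      using eq sub by (auto simp: F_def zz restrict_def fun_eq_iff split: if_splits)
    show "z = z'"
      using z ff by (auto simp: zz bb coinduced_def intro: PiE_ext)
  qed
  moreover have "F ` carrier (coinduced B X) \<subseteq> carrier B \<times> (carrier B \<rightarrow>\<^sub>E carrier X)"
    by (auto simp: F_def coinduced_def)
  ultimately have "carrier (coinduced B X) \<lesssim> carrier B \<times> (carrier B \<rightarrow>\<^sub>E carrier X)"
    unfolding lepoll_def by blast
  moreover have "small U (carrier B \<rightarrow>\<^sub>E carrier X)"
    using pow X(2) by (simp add: powers_small_def small_def)
  ultimately show ?thesis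
    using small_lepoll[OF small_Times[OF U B(2)]] by blast
qed

locale coinduction = B: monoid B + X: monoid X
  for B :: "('b, 'y) monoid_scheme" (structure) and X :: "('x, 'z) monoid_scheme" +
  assumes df: "dedekind_finite B"
begin

abbreviation "M \<equiv> coinduced B X"
abbreviation "\<sigma> \<equiv> coinduced_section B X"
abbreviation "idx \<equiv> fibre_index B"

lemma idx_mult:
  assumes "b \<in> carrier B" "b' \<in> carrier B" "c \<in> idx (b \<otimes> b')"
  shows "b \<in> Units B" "b' \<in> Units B" "c \<in> Units B"
  using assms dedekind_finite_Units[OF B.monoid_axioms df assms(1,2)]
  by (auto simp: fibre_index_def split: if_splits)

lemma in_carrier: "(b, f) \<in> carrier M \<longleftrightarrow> b \<in> carrier B \<and> f \<in> idx b \<rightarrow>\<^sub>E carrier X"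
  by (simp add: coinduced_def)

lemma mult_eq: "(b, f) \<otimes>\<^bsub>M\<^esub> (b', f') = (b \<otimes> b', \<lambda>c\<in>idx (b \<otimes> b'). f c \<otimes>\<^bsub>X\<^esub> f' (c \<otimes> b))"
  by (simp add: coinduced_def)

lemma one_eq: "\<one>\<^bsub>M\<^esub> = \<sigma> \<one>"
  by (simp add: coinduced_def coinduced_section_def)

lemma value_closed: "\<lbrakk>(b, f) \<in> carrier M; b \<in> Units B; c \<in> Units B\<rbrakk> \<Longrightarrow> f c \<in> carrier X"
  by (auto simp: in_carrier fibre_index_def PiE_iff)

lemma section_closed: "b \<in> carrier B \<Longrightarrow> \<sigma> b \<in> carrier M"
  by (simp add: coinduced_section_def in_carrier)

lemma eqI:
  assumes "(b, f) \<in> carrier M" "(b, f') \<in> carrier M" "\<And>c. c \<in> idx b \<Longrightarrow> f c = f' c"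
  shows "f = f'"
  using assms by (auto simp: in_carrier intro: PiE_ext)

lemma mult_closed:
  assumes "z \<in> carrier M" "z' \<in> carrier M" shows "z \<otimes>\<^bsub>M\<^esub> z' \<in> carrier M"
proof -
  obtain b f b' f' where zz: "z = (b, f)" "z' = (b', f')" by (cases z; cases z')
  have b: "b \<in> carrier B" "b' \<in> carrier B" using assms by (auto simp: zz in_carrier)
  have "f c \<otimes>\<^bsub>X\<^esub> f' (c \<otimes> b) \<in> carrier X" if "c \<in> idx (b \<otimes> b')" for c
    using idx_mult[OF b that] assms value_closed unfolding zz by (metis B.Units_m_closed X.m_closed)
  then show ?thesis unfolding zz mult_eq in_carrier using b by auto
qed

lemma monoid_coinduced: "monoid M"
proof (rule monoidI)
  show "\<one>\<^bsub>M\<^esub> \<in> carrier M" by (simp add: one_eq section_closed)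
next
  fix z assume z: "z \<in> carrier M"
  obtain b f where zz: "z = (b, f)" by (cases z)
  have b: "b \<in> carrier B" using z by (simp add: zz in_carrier)
  have f: "f \<in> extensional (idx b)" using z by (simp add: zz in_carrier PiE_iff)
  have fc: "f c \<in> carrier X" "c \<in> carrier B" "c \<in> Units B" "b \<in> Units B" if "c \<in> idx b" for c
    using that z value_closed by (auto simp: zz fibre_index_def split: if_splits)
  have one: "\<one> \<in> Units B" by simp
  show "\<one>\<^bsub>M\<^esub> \<otimes>\<^bsub>M\<^esub> z = z" "z \<otimes>\<^bsub>M\<^esub> \<one>\<^bsub>M\<^esub> = z"
    unfolding zz one_eq coinduced_section_def mult_eq
    using b f fc by (auto simp: restrict_def extensional_def fun_eq_iff fibre_index_def[of B \<one>])
next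
  fix z z' z'' assume z: "z \<in> carrier M" "z' \<in> carrier M" "z'' \<in> carrier M"
  obtain b f b' f' b'' f'' where zz: "z = (b, f)" "z' = (b', f')" "z'' = (b'', f'')"
    by (cases z; cases z'; cases z'')
  have b: "b \<in> carrier B" "b' \<in> carrier B" "b'' \<in> carrier B"
    using z by (auto simp: zz in_carrier)
  have "((\<lambda>c\<in>idx (b \<otimes> b'). f c \<otimes>\<^bsub>X\<^esub> f' (c \<otimes> b)) c) \<otimes>\<^bsub>X\<^esub> f'' (c \<otimes> (b \<otimes> b'))
      = f c \<otimes>\<^bsub>X\<^esub> ((\<lambda>c\<in>idx (b' \<otimes> b''). f' c \<otimes>\<^bsub>X\<^esub> f'' (c \<otimes> b')) (c \<otimes> b))"
    if c: "c \<in> idx (b \<otimes> b' \<otimes> b'')" for c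
  proof -
    have bb: "b \<otimes> b' \<in> Units B" "b'' \<in> Units B" "c \<in> Units B"
      using idx_mult[OF _ b(3) c] b by auto
    have b1: "b \<in> Units B" "b' \<in> Units B"
      using dedekind_finite_Units[OF B.monoid_axioms df b(1,2) bb(1)] by auto
    have "f c \<in> carrier X" "f' (c \<otimes> b) \<in> carrier X" "f'' (c \<otimes> (b \<otimes> b')) \<in> carrier X"
      using value_closed z bb b1 unfolding zz by (metis B.Units_m_closed)+
    then show ?thesis
      using bb b1 b B.Units_closed[OF bb(3)]
      by (simp add: fibre_index_def X.m_assoc B.m_assoc)
  qed
  then show "z \<otimes>\<^bsub>M\<^esub> z' \<otimes>\<^bsub>M\<^esub> z'' = z \<otimes>\<^bsub>M\<^esub> (z' \<otimes>\<^bsub>M\<^esub> z'')"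
    unfolding zz mult_eq using b by (auto simp: B.m_assoc restrict_def fun_eq_iff)
qed (rule mult_closed)

lemma section_mult:
  assumes b: "b \<in> carrier B" "b' \<in> carrier B"
  shows "\<sigma> (b \<otimes> b') = \<sigma> b \<otimes>\<^bsub>M\<^esub> \<sigma> b'"
proof -
  have "(\<lambda>c\<in>idx b. \<one>\<^bsub>X\<^esub>) c \<otimes>\<^bsub>X\<^esub> (\<lambda>c\<in>idx b'. \<one>\<^bsub>X\<^esub>) (c \<otimes> b) = \<one>\<^bsub>X\<^esub>"
    if "c \<in> idx (b \<otimes> b')" for c
    using idx_mult[OF b that] by (simp add: fibre_index_def)
  then show ?thesis
    unfolding coinduced_section_def mult_eq by (simp cong: restrict_cong)
qed

text \<open>All coordinates of \<open>(b, f)\<close> are recovered from the evaluation at \<open>1\<close> by multiplying on both sides with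
elements of the section so that the result lies in the kernel.  Hence an arrow into the cofree
extension is determined by its composite with the evaluation of the kernel at \<open>1\<close>.\<close>

lemma eval_conjugate:
  assumes z: "(b, f) \<in> carrier M" and b: "b \<in> Units B" and c: "c \<in> Units B"
  shows "snd (\<sigma> c \<otimes>\<^bsub>M\<^esub> (b, f) \<otimes>\<^bsub>M\<^esub> \<sigma> (inv (c \<otimes> b))) \<one> = f c"
  using value_closed[OF z b c] b c B.Units_closed[OF c]
  by (simp add: coinduced_section_def mult_eq fibre_index_def)

text \<open>Kernel and section generate the coinduced monoid, as required for a split extension.  Over a
non-unit the kernel factor may be trivial, since the fibre has only one element.\<close>

lemma factorisation:
  assumes z: "(b, f) \<in> carrier M"
  shows "\<exists>f'. (\<one>, f') \<in> carrier M \<and> (b, f) = (\<one>, f') \<otimes>\<^bsub>M\<^esub> \<sigma> b"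
proof (cases "b \<in> Units B")
  case True
  have "(\<one>, f) \<in> carrier M" using z True by (simp add: in_carrier fibre_index_def)
  moreover have "f = (\<lambda>c\<in>Units B. f c \<otimes>\<^bsub>X\<^esub> \<one>\<^bsub>X\<^esub>)"
    using z True value_closed[OF z True]
    by (auto simp: in_carrier fibre_index_def fun_eq_iff restrict_def PiE_iff extensional_def)
  ultimately show ?thesis
    using z True
    by (intro exI[of _ f]) (simp add: in_carrier coinduced_section_def mult_eq fibre_index_def cong: restrict_cong)
next
  case False
  then show ?thesis
    using z section_closed[OF B.one_closed]
    by (intro exI[of _ "snd (\<sigma> \<one>)"])
      (simp add: in_carrier coinduced_section_def mult_eq fibre_index_def restrict_def)
qed

end


text \<open>The couniversal arrow at \<open>X\<close> is evaluation of functions at \<open>1\<close>.  Given a split extension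
\<open>A \<rightarrow> G \<rightarrow> B\<close> and a homomorphism \<open>h : A \<rightarrow> X\<close>, an element \<open>g\<close> of \<open>G\<close> over a unit \<open>b\<close> must be sent to
the function \<open>c \<mapsto> h (s c g s (c b)\<inverse>)\<close>, whose argument lies over \<open>1\<close>, that is, in \<open>A\<close>; an element over a
non-unit has only one possible image.\<close>

theorem dedekind_finite_right_adjoint:
  assumes U: "size_universe U" and B: "B \<in> Ob (Mon U)" and pow: "powers_small U (carrier B)"
    and df: "dedekind_finite B"
  shows "has_right_adjoint (SpEx (Mon U) B) (Mon U) ker_functor"
proof (rule has_right_adjointI[OF is_functor_ker_functor[OF category_Mon]])
  fix X assume X: "X \<in> Ob (Mon U)"
  interpret B: monoid B using B by (simp add: Ob_Mon)
  interpret X: monoid X using X by (simp add: Ob_Mon)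
  interpret R: coinduction B X by unfold_locales (rule df)
  let ?M = "coinduced B X" and ?\<sigma> = "coinduced_section B X"
  have "small U (carrier ?M)"
    using B X small_coinduced[OF U B.monoid_axioms _ pow X.monoid_axioms] small_member
    by (auto simp: Ob_Mon)
  then obtain j where j: "inj_on j (carrier ?M)" and jU: "\<And>S. S \<subseteq> carrier ?M \<Longrightarrow> j ` S \<in> U"
    using small_encode[OF U] by metis
  define d where "d = inv_into (carrier ?M) j"
  define G' where "G' = copy j ?M"
  define q where "q z = fst (d z)" for z
  define t where "t b = j (?\<sigma> b)" for b
  have dj: "d (j z) = z" if "z \<in> carrier ?M" for z
    using j that by (simp add: d_def)
  have G'_carrier: "carrier G' = j ` carrier ?M" and G'_one: "\<one>\<^bsub>G'\<^esub> = t \<one>\<^bsub>B\<^esub>"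
    by (simp_all add: G'_def t_def R.one_eq)
  have G'_mult: "j z \<otimes>\<^bsub>G'\<^esub> j z' = j (z \<otimes>\<^bsub>?M\<^esub> z')" if "z \<in> carrier ?M" "z' \<in> carrier ?M" for z z'
    using mult_copy[OF j that] by (simp add: G'_def)
  have G': "G' \<in> Ob (Mon U)"
    using monoid_copy[OF R.monoid_coinduced j] jU by (simp add: Ob_Mon G'_def)
  have q: "q \<in> mhom G' B"
  proof (rule mhomI)
    show "q (a \<otimes>\<^bsub>G'\<^esub> b) = q a \<otimes>\<^bsub>B\<^esub> q b" if "a \<in> carrier G'" "b \<in> carrier G'" for a b
      using that R.mult_closed
      by (auto simp: G'_carrier G'_mult q_def dj R.mult_eq)
  qed (auto simp: G'_carrier G'_one q_def t_def dj R.in_carrier R.section_closed,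
       simp add: coinduced_section_def)
  have t: "t \<in> mhom B G'"
    by (rule mhomI) (simp_all add: G'_carrier G'_one t_def R.section_closed G'_mult R.section_mult)
  have qt: "q (t b) = b" if "b \<in> carrier B" for b
    using R.section_closed[OF that] by (simp add: q_def t_def dj) (simp add: coinduced_section_def)
  have span: "carrier G' \<subseteq> ext_span G' B q t"
  proof
    fix w assume "w \<in> carrier G'"
    then obtain b f where z: "(b, f) \<in> carrier ?M" and w: "w = j (b, f)"
      by (auto simp: G'_carrier)
    obtain f' where f': "(\<one>\<^bsub>B\<^esub>, f') \<in> carrier ?M" "(b, f) = (\<one>\<^bsub>B\<^esub>, f') \<otimes>\<^bsub>?M\<^esub> ?\<sigma> b"
      using R.factorisation[OF z] by blast
    have b: "b \<in> carrier B" using z by (simp add: R.in_carrier)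
    have "w = j (\<one>\<^bsub>B\<^esub>, f') \<otimes>\<^bsub>G'\<^esub> t b"
      using f' R.section_closed[OF b] by (simp add: w t_def G'_mult)
    moreover have "j (\<one>\<^bsub>B\<^esub>, f') \<in> ext_span G' B q t"
      by (rule ext_span.ker) (use f'(1) in \<open>auto simp: G'_carrier q_def dj\<close>)
    ultimately show "w \<in> ext_span G' B q t"
      using ext_span.mult ext_span.sec[OF b] by metis
  qed
  let ?E' = "split_ext_of G' B q t" and ?K' = "ker_monoid G' B q"
  note E' = is_split_ext_of[OF U G' B q t qt span]
  note K' = ker_monoid_Ob[OF U G' B q]
  define ev where "ev z = snd (d z) \<one>\<^bsub>B\<^esub>" for z
  have ev: "ev \<in> mhom ?K' X"
  proof (rule mhomI)
    fix a assume "a \<in> carrier ?K'"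
    then show "ev a \<in> carrier X"
      by (auto simp: G'_carrier q_def ev_def dj dest: R.value_closed[OF _ B.Units_one_closed B.Units_one_closed])
  next
    fix a b assume ab: "a \<in> carrier ?K'" "b \<in> carrier ?K'"
    then obtain f f' where "(\<one>\<^bsub>B\<^esub>, f) \<in> carrier ?M" "a = j (\<one>\<^bsub>B\<^esub>, f)"
      "(\<one>\<^bsub>B\<^esub>, f') \<in> carrier ?M" "b = j (\<one>\<^bsub>B\<^esub>, f')"
      by (auto simp: G'_carrier q_def dj)
    then show "ev (a \<otimes>\<^bsub>?K'\<^esub> b) = ev a \<otimes>\<^bsub>X\<^esub> ev b"
      using R.mult_closed[of "(\<one>\<^bsub>B\<^esub>, f)" "(\<one>\<^bsub>B\<^esub>, f')"]
      by (simp add: ev_def G'_mult dj) (simp add: R.mult_eq fibre_index_def)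
  next
    show "ev \<one>\<^bsub>?K'\<^esub> = \<one>\<^bsub>X\<^esub>"
      using R.section_closed[OF B.one_closed]
      by (simp add: ev_def G'_one t_def dj) (simp add: coinduced_section_def fibre_index_def)
  qed
  let ?\<epsilon> = "arrow ?K' ev X"
  have "couniversal (SpEx (Mon U) B) (Mon U) ker_functor X ?E' ?\<epsilon>"
    unfolding couniversal_def
  proof (intro conjI ballI)
    show "?E' \<in> Ob (SpEx (Mon U) B)" using E' by (simp add: SpEx_def)
    show "?\<epsilon> \<in> Hom (Mon U) (on_ob ker_functor ?E') X"
      using arrow_in_Hom[OF K' X ev] by (simp add: ker_functor_def split_ext_of_def)
  next
    fix E H assume "E \<in> Ob (SpEx (Mon U) B)"
      and H: "H \<in> Hom (Mon U) (on_ob ker_functor E) X"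
    then have E: "is_split_ext (Mon U) B E" by (simp add: SpEx_def)
    obtain A G k p s r where
      E_eq: "E = \<lparr>ext_A = A, ext_G = G, ext_\<kappa> = arrow A k G, ext_p = arrow G p B, ext_s = arrow B s G\<rparr>"
      and A: "A \<in> Ob (Mon U)" and G: "G \<in> Ob (Mon U)"
      and k: "k \<in> mhom A G" and p: "p \<in> mhom G B" and s: "s \<in> mhom B G"
      and ps: "\<And>b. b \<in> carrier B \<Longrightarrow> p (s b) = b"
      and pk: "\<And>a. a \<in> carrier A \<Longrightarrow> p (k a) = \<one>\<^bsub>B\<^esub>"
      and r: "r \<in> mhom (ker_monoid G B p) A" and rk: "\<And>a. a \<in> carrier A \<Longrightarrow> r (k a) = a"
      and kr: "\<And>g. \<lbrakk>g \<in> carrier G; p g = \<one>\<^bsub>B\<^esub>\<rbrakk> \<Longrightarrow> k (r g) = g"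
      by (rule split_ext_MonE[OF U E]) (rule that)
    interpret G: monoid G using G by (simp add: Ob_Mon)
    obtain h where h: "H = arrow A h X" "h \<in> mhom A X"
      using H by (auto simp: E_eq ker_functor_def elim: Hom_MonE)
    \<comment> \<open>The element over \<open>1\<close> at which \<open>h\<close> yields the coordinate \<open>c\<close> of the image of \<open>g\<close>;
      here \<open>r\<close> identifies the fibre of \<open>p\<close> over \<open>1\<close> with \<open>A\<close>.\<close>
    define conj where "conj c g = s c \<otimes>\<^bsub>G\<^esub> g \<otimes>\<^bsub>G\<^esub> s (inv\<^bsub>B\<^esub> (c \<otimes>\<^bsub>B\<^esub> p g))" for c g
    have conj: "conj c g \<in> carrier G" "p (conj c g) = \<one>\<^bsub>B\<^esub>"
      if "g \<in> carrier G" "p g \<in> Units B" "c \<in> Units B" for c g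
    proof -
      have cg: "c \<otimes>\<^bsub>B\<^esub> p g \<in> Units B" using that by simp
      then show "conj c g \<in> carrier G" "p (conj c g) = \<one>\<^bsub>B\<^esub>"
        using that by (simp_all add: conj_def mhomD[OF s] mhomD[OF p] ps B.Units_closed)
    qed
    \<comment> \<open>This cocycle identity is what makes \<open>\<Phi>\<close> below multiplicative.\<close>
    have conj_mult: "conj c (g \<otimes>\<^bsub>G\<^esub> g') = conj c g \<otimes>\<^bsub>G\<^esub> conj (c \<otimes>\<^bsub>B\<^esub> p g) g'"
      if g: "g \<in> carrier G" "p g \<in> Units B" "g' \<in> carrier G" "p g' \<in> Units B" and c: "c \<in> Units B"
      for c g g'
    proof -
      let ?b = "c \<otimes>\<^bsub>B\<^esub> p g"
      have u: "?b \<in> Units B" "?b \<otimes>\<^bsub>B\<^esub> p g' \<in> Units B" using g c by simp_all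
      have cl: "s c \<in> carrier G" "s ?b \<in> carrier G" "s (inv\<^bsub>B\<^esub> ?b) \<in> carrier G"
        "s (inv\<^bsub>B\<^esub> (?b \<otimes>\<^bsub>B\<^esub> p g')) \<in> carrier G"
        using u c by (auto intro!: mhomD(1)[OF s])
      have "s (inv\<^bsub>B\<^esub> ?b) \<otimes>\<^bsub>G\<^esub> s ?b = \<one>\<^bsub>G\<^esub>"
        using u(1) by (simp add: mhomD(2)[OF s, symmetric] mhomD(3)[OF s] B.Units_closed)
      then have cancel: "s (inv\<^bsub>B\<^esub> ?b) \<otimes>\<^bsub>G\<^esub> (s ?b \<otimes>\<^bsub>G\<^esub> w) = w" if "w \<in> carrier G" for w
        using cl that by (simp add: G.m_assoc[symmetric])
      have "c \<otimes>\<^bsub>B\<^esub> p (g \<otimes>\<^bsub>G\<^esub> g') = ?b \<otimes>\<^bsub>B\<^esub> p g'"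
        using g c by (simp add: mhomD[OF p] B.m_assoc B.Units_closed)
      then show ?thesis
        using cl g by (simp add: conj_def G.m_assoc cancel)
    qed
    define \<Phi> where "\<Phi> g = (p g, \<lambda>c\<in>fibre_index B (p g). h (r (conj c g)))" for g
    have rconj: "r (conj c g) \<in> carrier A" if "g \<in> carrier G" "p g \<in> Units B" "c \<in> Units B" for c g
      using conj[OF that] mhomD(1)[OF r] by simp
    have \<Phi>_closed: "\<Phi> g \<in> carrier ?M" if "g \<in> carrier G" for g
      using that rconj mhomD(1)[OF h(2)] mhomD(1)[OF p]
      by (auto simp: \<Phi>_def R.in_carrier fibre_index_def)
    have \<Phi>_mult: "\<Phi> (g \<otimes>\<^bsub>G\<^esub> g') = \<Phi> g \<otimes>\<^bsub>?M\<^esub> \<Phi> g'" if g: "g \<in> carrier G" "g' \<in> carrier G" for g g'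
    proof -
      have "h (r (conj c (g \<otimes>\<^bsub>G\<^esub> g'))) =
          (\<lambda>c\<in>fibre_index B (p g). h (r (conj c g))) c \<otimes>\<^bsub>X\<^esub>
          (\<lambda>c\<in>fibre_index B (p g'). h (r (conj c g'))) (c \<otimes>\<^bsub>B\<^esub> p g)"
        if c: "c \<in> fibre_index B (p g \<otimes>\<^bsub>B\<^esub> p g')" for c
      proof -
        note u = R.idx_mult[OF mhomD(1)[OF p g(1)] mhomD(1)[OF p g(2)] c]
        have cg: "c \<otimes>\<^bsub>B\<^esub> p g \<in> Units B" using u by simp
        show ?thesis
          using u cg g conj[OF g(1) u(1,3)] conj[OF g(2) u(2) cg] rconj[OF g(1) u(1,3)]
            rconj[OF g(2) u(2) cg]
            mhomD(2)[OF r, of "conj c g" "conj (c \<otimes>\<^bsub>B\<^esub> p g) g'"]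
          by (simp add: fibre_index_def conj_mult mhomD(2)[OF h(2)])
      qed
      then show ?thesis
        using g by (simp add: \<Phi>_def R.mult_eq mhomD(2)[OF p] cong: restrict_cong)
    qed
    have \<Phi>_sec: "\<Phi> (s b) = ?\<sigma> b" if b: "b \<in> carrier B" for b
    proof -
      have "h (r (conj c (s b))) = \<one>\<^bsub>X\<^esub>" if c: "c \<in> fibre_index B b" for c
      proof -
        have u: "b \<in> Units B" "c \<in> Units B" "c \<otimes>\<^bsub>B\<^esub> b \<in> Units B"
          using c by (auto simp: fibre_index_def split: if_splits)
        have "conj c (s b) = \<one>\<^bsub>G\<^esub>"
          using b u by (simp add: conj_def ps mhomD(2)[OF s, symmetric] mhomD(3)[OF s] B.Units_closed)
        then show ?thesis
          using mhomD(3)[OF r] mhomD(3)[OF h(2)] by simp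
      qed
      then show ?thesis
        using b by (simp add: \<Phi>_def coinduced_section_def ps cong: restrict_cong)
    qed
    define \<phi> where "\<phi> g = j (\<Phi> g)" for g
    have \<phi>s: "\<phi> (s b) = t b" if "b \<in> carrier B" for b
      using that by (simp add: \<phi>_def t_def \<Phi>_sec)
    have \<phi>: "\<phi> \<in> mhom G G'"
    proof (rule mhomI)
      show "\<phi> \<one>\<^bsub>G\<^esub> = \<one>\<^bsub>G'\<^esub>"
        using \<phi>s[OF B.one_closed] by (simp add: G'_one mhomD(3)[OF s])
    qed (simp_all add: \<phi>_def G'_carrier \<Phi>_closed \<Phi>_mult G'_mult)
    have q\<phi>: "q (\<phi> g) = p g" if "g \<in> carrier G" for g
      using \<Phi>_closed[OF that] by (simp add: q_def \<phi>_def dj) (simp add: \<Phi>_def)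
    let ?u = "(E, arrow A (\<lambda>a. \<phi> (k a)) ?K', arrow G \<phi> G', ?E')"
    have u: "?u \<in> Hom (SpEx (Mon U) B) E ?E'"
      by (rule SpEx_arrow_into_split_ext_of[OF E E' E_eq A G K' G' k p s pk \<phi> q\<phi> \<phi>s])
    have \<phi>k: "(\<lambda>a. \<phi> (k a)) \<in> mhom A ?K'"
      by (rule mhomI) (simp_all add: mhomD[OF k] mhomD[OF \<phi>] q\<phi> pk)
    have ev\<phi>: "ev (\<phi> (k a)) = h a" if a: "a \<in> carrier A" for a
    proof -
      have ka: "k a \<in> carrier G" using mhomD(1)[OF k a] .
      have "conj \<one>\<^bsub>B\<^esub> (k a) = k a"
        using ka by (simp add: conj_def pk a mhomD(3)[OF s])
      then show ?thesis
        using \<Phi>_closed[OF ka]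
        by (simp add: ev_def \<phi>_def dj) (simp add: \<Phi>_def pk a fibre_index_def rk)
    qed
    show "\<exists>!u. u \<in> Hom (SpEx (Mon U) B) E ?E' \<and> ?\<epsilon> \<cdot>\<^bsub>Mon U\<^esub> on_ar ker_functor u = H"
    proof (rule ex1I)
      show "?u \<in> Hom (SpEx (Mon U) B) E ?E' \<and> ?\<epsilon> \<cdot>\<^bsub>Mon U\<^esub> on_ar ker_functor ?u = H"
        using u \<phi>k ev\<phi> by (simp add: ker_functor_def Cmp_arrow h(1) arrow_eq_iff)
    next
      fix v assume v: "v \<in> Hom (SpEx (Mon U) B) E ?E' \<and> ?\<epsilon> \<cdot>\<^bsub>Mon U\<^esub> on_ar ker_functor v = H"
      then obtain vA vG where v_eq: "v = (E, vA, vG, ?E')"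
        by (cases v) (auto simp: Hom_SpEx)
      have vH: "vA \<in> Hom (Mon U) A ?K'" "vG \<in> Hom (Mon U) G G'"
        and comm: "vG \<cdot>\<^bsub>Mon U\<^esub> arrow A k G = arrow ?K' (\<lambda>x. x) G' \<cdot>\<^bsub>Mon U\<^esub> vA"
          "arrow G' q B \<cdot>\<^bsub>Mon U\<^esub> vG = arrow G p B" "vG \<cdot>\<^bsub>Mon U\<^esub> arrow B s G = arrow B t G'"
        using v by (simp_all add: v_eq Hom_SpEx E_eq split_ext_of_def)
      obtain a where a: "vA = arrow A a ?K'" "a \<in> mhom A ?K'" using vH(1) by (rule Hom_MonE)
      obtain \<psi> where \<psi>: "vG = arrow G \<psi> G'" "\<psi> \<in> mhom G G'" using vH(2) by (rule Hom_MonE)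
      have i: "(\<lambda>x. x) \<in> mhom ?K' G'" by (rule mhomI) auto
      have \<psi>k: "\<psi> (k y) = a y" if "y \<in> carrier A" for y
        using comm(1) that i a(2) k by (simp add: a(1) \<psi>(1) Cmp_arrow arrow_eq_iff)
      have q\<psi>: "q (\<psi> g) = p g" if "g \<in> carrier G" for g
        using comm(2) that \<psi>(2) by (simp add: \<psi>(1) Cmp_arrow arrow_eq_iff)
      have \<psi>s: "\<psi> (s b) = t b" if "b \<in> carrier B" for b
        using comm(3) that s by (simp add: \<psi>(1) Cmp_arrow arrow_eq_iff)
      have ha: "ev (a y) = h y" if "y \<in> carrier A" for y
        using v that a(2) by (simp add: v_eq ker_functor_def a(1) h(1) Cmp_arrow arrow_eq_iff)
      have "\<psi> g = \<phi> g" if g: "g \<in> carrier G" for g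
      proof -
        obtain b f where z: "(b, f) \<in> carrier ?M" and \<psi>g: "\<psi> g = j (b, f)"
          using mhomD(1)[OF \<psi>(2) g] by (auto simp: G'_carrier)
        have b: "b = p g" using q\<psi>[OF g] z by (simp add: \<psi>g q_def dj)
        have fc: "f c = h (r (conj c g))" if c: "c \<in> fibre_index B (p g)" for c
        proof -
          have un: "p g \<in> Units B" "c \<in> Units B" "c \<otimes>\<^bsub>B\<^esub> p g \<in> Units B"
            using c by (auto simp: fibre_index_def split: if_splits)
          have cl: "c \<in> carrier B" "inv\<^bsub>B\<^esub> (c \<otimes>\<^bsub>B\<^esub> p g) \<in> carrier B"
            using un by auto
          have \<sigma>cl: "?\<sigma> c \<in> carrier ?M" "?\<sigma> (inv\<^bsub>B\<^esub> (c \<otimes>\<^bsub>B\<^esub> p g)) \<in> carrier ?M"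
            using cl by (auto intro: R.section_closed)
          have "\<psi> (conj c g) = j (?\<sigma> c \<otimes>\<^bsub>?M\<^esub> (b, f) \<otimes>\<^bsub>?M\<^esub> ?\<sigma> (inv\<^bsub>B\<^esub> (c \<otimes>\<^bsub>B\<^esub> p g)))"
            using g cl z R.mult_closed \<sigma>cl
            by (simp add: conj_def mhomD(2)[OF \<psi>(2)] mhomD(1)[OF s] \<psi>s \<psi>g)
              (simp add: t_def G'_mult)
          moreover have "?\<sigma> c \<otimes>\<^bsub>?M\<^esub> (b, f) \<otimes>\<^bsub>?M\<^esub> ?\<sigma> (inv\<^bsub>B\<^esub> (c \<otimes>\<^bsub>B\<^esub> p g)) \<in> carrier ?M"
            by (intro R.mult_closed \<sigma>cl z)
          ultimately have "ev (\<psi> (conj c g)) = f c"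
            using R.eval_conjugate[OF z _ un(2)] un by (simp add: ev_def dj b)
          moreover have "\<psi> (conj c g) = a (r (conj c g))"
            using \<psi>k[OF rconj[OF g un(1,2)]] kr[OF conj[OF g un(1,2)]] by simp
          ultimately show ?thesis
            using ha[OF rconj[OF g un(1,2)]] by simp
        qed
        have "f = (\<lambda>c\<in>fibre_index B (p g). h (r (conj c g)))"
          by (rule R.eqI[of "p g"]) (use z \<Phi>_closed[OF g] fc in \<open>auto simp: b \<Phi>_def\<close>)
        then show ?thesis by (simp add: \<psi>g \<phi>_def \<Phi>_def b)
      qed
      then have "vG = arrow G \<phi> G'" by (simp add: \<psi>(1) arrow_eq_iff)
      then show "v = ?u"
        using SpEx_arrow_eqI[OF U _ u] v by (auto simp: v_eq)
    qed
  qed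
  then show "\<exists>e \<epsilon>. couniversal (SpEx (Mon U) B) (Mon U) ker_functor X e \<epsilon>" by blast
qed

section \<open>The obstruction over other monoids\<close>

text \<open>The free product of \<open>B\<close> with the free monoid on two letters \<open>\<lambda>\<close> and \<open>\<rho>\<close> consists of alternating words.
Here only the words \<open>b\<close>, \<open>b \<lambda> c\<close>, \<open>b \<rho> c\<close> and \<open>b \<lambda> c \<rho> d\<close> are kept apart, which the first four
constructors represent in this order, and all others are identified
when they have the same image in \<open>B\<close> under the map that deletes the letters.  \<open>Collapsed b\<close> is the
class of the other words over \<open>b\<close>; these classes form an ideal, so the quotient is again a monoid over \<open>B\<close>.\<close>

datatype 'b word = Plain 'b | Lft 'b 'b | Rgt 'b 'b | Both 'b 'b 'b | Collapsed 'b

fun word_value :: "('b, 'y) monoid_scheme \<Rightarrow> 'b word \<Rightarrow> 'b" where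
  "word_value B (Plain b) = b"
| "word_value B (Lft b c) = b \<otimes>\<^bsub>B\<^esub> c"
| "word_value B (Rgt b c) = b \<otimes>\<^bsub>B\<^esub> c"
| "word_value B (Both b c d) = b \<otimes>\<^bsub>B\<^esub> c \<otimes>\<^bsub>B\<^esub> d"
| "word_value B (Collapsed b) = b"

fun word_mult :: "('b, 'y) monoid_scheme \<Rightarrow> 'b word \<Rightarrow> 'b word \<Rightarrow> 'b word" where
  "word_mult B (Plain a) (Plain b) = Plain (a \<otimes>\<^bsub>B\<^esub> b)"
| "word_mult B (Plain a) (Lft b c) = Lft (a \<otimes>\<^bsub>B\<^esub> b) c"
| "word_mult B (Plain a) (Rgt b c) = Rgt (a \<otimes>\<^bsub>B\<^esub> b) c"
| "word_mult B (Plain a) (Both b c d) = Both (a \<otimes>\<^bsub>B\<^esub> b) c d"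
| "word_mult B (Lft b c) (Plain a) = Lft b (c \<otimes>\<^bsub>B\<^esub> a)"
| "word_mult B (Rgt b c) (Plain a) = Rgt b (c \<otimes>\<^bsub>B\<^esub> a)"
| "word_mult B (Both b c d) (Plain a) = Both b c (d \<otimes>\<^bsub>B\<^esub> a)"
| "word_mult B (Lft a b) (Rgt c d) = Both a (b \<otimes>\<^bsub>B\<^esub> c) d"
| "word_mult B u v = Collapsed (word_value B u \<otimes>\<^bsub>B\<^esub> word_value B v)"

text \<open>\<open>l\<close> permits the letter \<open>\<lambda>\<close> and \<open>r\<close> the letter \<open>\<rho>\<close>.  Collapsed words are always included, since
already the squares of the letters collapse.\<close>

fun allowed :: "bool \<Rightarrow> bool \<Rightarrow> 'b word \<Rightarrow> bool" where
  "allowed l r (Lft b c) = l"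
| "allowed l r (Rgt b c) = r"
| "allowed l r (Both b c d) = (l \<and> r)"
| "allowed l r _ = True"

definition word_monoid :: "('b, 'y) monoid_scheme \<Rightarrow> bool \<Rightarrow> bool \<Rightarrow> 'b word monoid" where
  "word_monoid B l r = \<lparr>carrier = {w. set_word w \<subseteq> carrier B \<and> allowed l r w},
     mult = word_mult B, one = Plain \<one>\<^bsub>B\<^esub>\<rparr>"

lemma word_monoid_simps [simp]:
  "w \<in> carrier (word_monoid B l r) \<longleftrightarrow> set_word w \<subseteq> carrier B \<and> allowed l r w"
  "u \<otimes>\<^bsub>word_monoid B l r\<^esub> v = word_mult B u v"
  "\<one>\<^bsub>word_monoid B l r\<^esub> = Plain \<one>\<^bsub>B\<^esub>"
  by (simp_all add: word_monoid_def)

context monoid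
begin

lemma word_value_closed: "set_word w \<subseteq> carrier G \<Longrightarrow> word_value G w \<in> carrier G"
  by (cases w) auto

lemma word_value_mult:
  "\<lbrakk>set_word u \<subseteq> carrier G; set_word v \<subseteq> carrier G\<rbrakk> \<Longrightarrow>
    word_value G (word_mult G u v) = word_value G u \<otimes> word_value G v"
  by (cases u; cases v) (auto simp: m_assoc)

lemma monoid_word_monoid: "monoid (word_monoid G l r)"
proof (rule monoidI)
  fix u v assume "u \<in> carrier (word_monoid G l r)" "v \<in> carrier (word_monoid G l r)"
  then show "u \<otimes>\<^bsub>word_monoid G l r\<^esub> v \<in> carrier (word_monoid G l r)"
    by (cases u; cases v) auto
next
  fix u v w assume uvw: "u \<in> carrier (word_monoid G l r)" "v \<in> carrier (word_monoid G l r)"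
    "w \<in> carrier (word_monoid G l r)"
  then show "u \<otimes>\<^bsub>word_monoid G l r\<^esub> v \<otimes>\<^bsub>word_monoid G l r\<^esub> w
      = u \<otimes>\<^bsub>word_monoid G l r\<^esub> (v \<otimes>\<^bsub>word_monoid G l r\<^esub> w)"
    by (cases u; cases v; cases w) (auto simp: m_assoc)
next
  fix u assume "u \<in> carrier (word_monoid G l r)"
  then show "\<one>\<^bsub>word_monoid G l r\<^esub> \<otimes>\<^bsub>word_monoid G l r\<^esub> u = u"
    "u \<otimes>\<^bsub>word_monoid G l r\<^esub> \<one>\<^bsub>word_monoid G l r\<^esub> = u"
    by (cases u; auto)+
qed auto

text \<open>An endomorphism of the kernel, though not of the whole word monoid, that moves only the word
\<open>x \<lambda> \<rho> y\<close>.\<close>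

definition collapse :: "'a \<Rightarrow> 'a \<Rightarrow> 'a word \<Rightarrow> 'a word" where
  "collapse x y w = (if w = Both x \<one> y then Collapsed \<one> else w)"

text \<open>The word \<open>x \<lambda> \<rho> y\<close> is not a product \<open>(x \<lambda> b) (c \<rho> y)\<close> of two words over \<open>1\<close>: such a factorisation would
require \<open>b c = 1\<close>, and cancelling would give \<open>b = y\<close> and \<open>c = x\<close>.\<close>

lemma middle_product_neq_one:
  assumes xy: "x \<in> carrier G" "y \<in> carrier G" "y \<otimes> x \<noteq> \<one>"
    and b: "b \<in> carrier G" "x \<otimes> b = \<one>" and c: "c \<in> carrier G" "c \<otimes> y = \<one>"
  shows "b \<otimes> c \<noteq> \<one>"
proof
  assume bc: "b \<otimes> c = \<one>"
  have "b = b \<otimes> (c \<otimes> y)" using b c by simp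
  also have "\<dots> = y" using b(1) c(1) xy(2) bc by (simp add: m_assoc[symmetric])
  finally have "b = y" .
  moreover have "c = x \<otimes> b \<otimes> c" using b c by simp
  then have "c = x" using b(1) c(1) xy(1) bc by (simp add: m_assoc)
  ultimately show False using bc xy(3) by simp
qed

text \<open>A product of two words over \<open>1\<close> that differ from the unit either collapses or has the form
\<open>(a \<lambda> b) (c \<rho> d)\<close>.  By the previous lemma \<open>x \<lambda> \<rho> y\<close> is not of this form, so its only factorisations
over \<open>1\<close> are those with a unit factor.\<close>

lemma collapse_mult:
  assumes xy: "x \<in> carrier G" "y \<in> carrier G" "x \<otimes> y = \<one>" "y \<otimes> x \<noteq> \<one>"
    and u: "set_word u \<subseteq> carrier G" "word_value G u = \<one>"
    and v: "set_word v \<subseteq> carrier G" "word_value G v = \<one>"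
  shows "collapse x y (word_mult G u v) = word_mult G (collapse x y u) (collapse x y v)"
  using u v middle_product_neq_one[OF xy(1,2,4)] xy(3)
  by (cases u; cases v) (auto simp: collapse_def)

lemma small_words:
  assumes U: "size_universe U" and B: "small U (carrier G)"
  shows "small U {w. set_word w \<subseteq> carrier G}"
proof -
  define code :: "'a word \<Rightarrow> nat \<times> 'a \<times> 'a \<times> 'a" where
    "code w = (case w of Plain b \<Rightarrow> (0, b, b, b) | Lft b c \<Rightarrow> (1, b, c, c) | Rgt b c \<Rightarrow> (2, b, c, c)
       | Both b c d \<Rightarrow> (3, b, c, d) | Collapsed b \<Rightarrow> (4, b, b, b))" for w
  have "inj_on code {w. set_word w \<subseteq> carrier G}"
  proof (rule inj_onI)
    fix u v assume "code u = code v"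
    then show "u = v" by (cases u; cases v; simp add: code_def)
  qed
  moreover have "code ` {w. set_word w \<subseteq> carrier G} \<subseteq> UNIV \<times> carrier G \<times> carrier G \<times> carrier G"
      proof (rule image_subsetI)
    fix w assume "w \<in> {w. set_word w \<subseteq> carrier G}"
    then show "code w \<in> UNIV \<times> carrier G \<times> carrier G \<times> carrier G"
      by (cases w) (simp_all add: code_def)
  qed
  ultimately have "{w. set_word w \<subseteq> carrier G} \<lesssim> (UNIV :: nat set) \<times> carrier G \<times> carrier G \<times> carrier G"
    unfolding lepoll_def by blast
  moreover have "small U ((UNIV :: nat set) \<times> carrier G \<times> carrier G \<times> carrier G)"
    by (intro small_Times U small_nat B)
  ultimately show ?thesis using small_lepoll by blast
qed

end

text \<open>The sub-extensions of words in \<open>\<lambda>\<close> alone and of words in \<open>\<rho>\<close> alone generate the extension of all words, so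
their inclusions are jointly epic.  Their restrictions to kernels are not: the identity and the
collapsing endomorphism agree on both sub-kernels but differ at \<open>x \<lambda> \<rho> y\<close>.\<close>

theorem no_right_adjoint_if_not_dedekind_finite:
  assumes U: "size_universe U" and B: "B \<in> Ob (Mon U)" and ndf: "\<not> dedekind_finite B"
  shows "\<not> has_right_adjoint (SpEx (Mon U) B) (Mon U) ker_functor"
proof
  assume adj: "has_right_adjoint (SpEx (Mon U) B) (Mon U) ker_functor"
  interpret B: monoid B using B by (simp add: Ob_Mon)
  obtain x y where xy: "x \<in> carrier B" "y \<in> carrier B" "x \<otimes>\<^bsub>B\<^esub> y = \<one>\<^bsub>B\<^esub>" "y \<otimes>\<^bsub>B\<^esub> x \<noteq> \<one>\<^bsub>B\<^esub>"
    using ndf unfolding dedekind_finite_def by blast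
  define W where "W = {w. set_word w \<subseteq> carrier B}"
  have "small U W"
    using B.small_words[OF U] B small_member by (auto simp: Ob_Mon W_def)
  then obtain j where j: "inj_on j W" and jU: "\<And>S. S \<subseteq> W \<Longrightarrow> j ` S \<in> U"
    using small_encode[OF U] by metis
  define q where "q z = word_value B (inv_into W j z)" for z
  define t where "t b = j (Plain b)" for b
  define N where "N l r = copy j (word_monoid B l r)" for l r
  define E where "E l r = split_ext_of (N l r) B q t" for l r
  have qj: "q (j w) = word_value B w" if "w \<in> W" for w
    using j that by (simp add: q_def)
  have sub: "carrier (word_monoid B l r) \<subseteq> W" for l r
    by (auto simp: W_def)
  have carr: "carrier (N l r) = j ` {w \<in> W. allowed l r w}" for l r
    unfolding N_def carrier_copy by (rule arg_cong[of _ _ "image j"]) (auto simp: W_def)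
  have N_mult: "j u \<otimes>\<^bsub>N l r\<^esub> j v = j (word_mult B u v)"
    if "u \<in> W" "v \<in> W" "allowed l r u" "allowed l r v" for u v l r
    using mult_copy[OF inj_on_subset[OF j sub], of u l r v] that by (simp add: N_def W_def)
  have N_one: "\<one>\<^bsub>N l r\<^esub> = j (Plain \<one>\<^bsub>B\<^esub>)" for l r
    by (simp add: N_def)
  have N: "N l r \<in> Ob (Mon U)" for l r
    using monoid_copy[OF B.monoid_word_monoid inj_on_subset[OF j sub]] jU[OF sub]
    by (simp add: Ob_Mon N_def)
  have mult_W: "word_mult B u v \<in> W" if "u \<in> W" "v \<in> W" for u v
    using that by (cases u; cases v) (auto simp: W_def)
  have q: "q \<in> mhom (N l r) B" for l r
  proof (rule mhomI)
    fix a b assume "a \<in> carrier (N l r)" "b \<in> carrier (N l r)"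
    then show "q (a \<otimes>\<^bsub>N l r\<^esub> b) = q a \<otimes>\<^bsub>B\<^esub> q b"
      by (auto simp: carr N_mult qj mult_W) (simp add: W_def B.word_value_mult)
  next
    show "q \<one>\<^bsub>N l r\<^esub> = \<one>\<^bsub>B\<^esub>" by (simp add: N_one qj W_def)
  qed (auto simp: carr qj, simp add: W_def B.word_value_closed)
  have t: "t \<in> mhom B (N l r)" for l r
    by (rule mhomI) (auto simp: t_def carr N_one N_mult W_def)
  have qt: "q (t b) = b" if "b \<in> carrier B" for b
    using that by (simp add: t_def qj W_def)
  have span: "carrier (N l r) \<subseteq> ext_span (N l r) B q t" for l r
  proof
    fix z assume "z \<in> carrier (N l r)"
    then obtain w where z: "z = j w" and w: "w \<in> W" "allowed l r w" by (auto simp: carr)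
    let ?S = "ext_span (N l r) B q t"
    have plain: "j (Plain b) \<in> ?S" if "b \<in> carrier B" for b
      using ext_span.sec[OF that, of t "N l r" q] by (simp add: t_def)
    have ker: "j w \<in> ?S" if "w \<in> W" "allowed l r w" "word_value B w = \<one>\<^bsub>B\<^esub>" for w
      by (rule ext_span.ker) (use that in \<open>auto simp: carr qj\<close>)
    have prod: "j (word_mult B u v) \<in> ?S"
      if "j u \<in> ?S" "j v \<in> ?S" "u \<in> W" "v \<in> W" "allowed l r u" "allowed l r v" for u v
      using ext_span.mult[OF that(1,2)] that by (simp add: N_mult)
    have L: "j (Lft b c) \<in> ?S" if "b \<in> carrier B" "c \<in> carrier B" l for b c
      using prod[OF plain[OF that(1)] prod[OF ker[of "Lft \<one>\<^bsub>B\<^esub> \<one>\<^bsub>B\<^esub>"] plain[OF that(2)]]] that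
      by (simp add: W_def)
    have R: "j (Rgt b c) \<in> ?S" if "b \<in> carrier B" "c \<in> carrier B" r for b c
      using prod[OF plain[OF that(1)] prod[OF ker[of "Rgt \<one>\<^bsub>B\<^esub> \<one>\<^bsub>B\<^esub>"] plain[OF that(2)]]] that
      by (simp add: W_def)
    show "z \<in> ?S"
    proof (cases w)
      case (Plain b)
      then show ?thesis using plain w by (simp add: z W_def)
    next
      case (Lft b c)
      then show ?thesis using L w by (simp add: z W_def)
    next
      case (Rgt b c)
      then show ?thesis using R w by (simp add: z W_def)
    next
      case (Both b c d)
      then show ?thesis
        using prod[OF L[of b c] R[of "\<one>\<^bsub>B\<^esub>" d]] w by (simp add: z W_def)
    next
      case (Collapsed b)
      then show ?thesis
        using prod[OF ker[of "Collapsed \<one>\<^bsub>B\<^esub>"] plain[of b]] w by (simp add: z W_def)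
    qed
  qed
  have E: "is_split_ext (Mon U) B (E l r)" for l r
    unfolding E_def by (rule is_split_ext_of[OF U N B q t qt span])
  let ?K = "\<lambda>l r. ker_monoid (N l r) B q"
  note K = ker_monoid_Ob[OF U N B q]
  define \<iota> where "\<iota> l r = (E l r, arrow (?K l r) (\<lambda>z. z) (?K True True), arrow (N l r) (\<lambda>z. z) (N True True),
    E True True)" for l r
  have incl: "(\<lambda>z. z) \<in> mhom (N l r) (N True True)" for l r
    by (rule mhomI) (auto simp: carr N_one N_mult W_def elim!: allowed.elims)
  have inclK: "(\<lambda>z. z) \<in> mhom (?K l r) (?K True True)" for l r
    by (rule mhomI) (use incl[of l r] in \<open>auto simp: mhom_def hom_def\<close>)
  have \<iota>: "\<iota> l r \<in> Hom (SpEx (Mon U) B) (E l r) (E True True)" for l r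
    unfolding \<iota>_def E_def
    by (rule SpEx_arrow_into_split_ext_of[OF E[unfolded E_def] E[unfolded E_def]
          split_ext_of_def K N K N _ q t _ incl])
      (auto intro: mhomI)
  \<comment> \<open>The two generating sub-extensions: words without \<open>\<rho>\<close> and words without \<open>\<lambda>\<close>.\<close>
  define S where "S = {\<iota> True False, \<iota> False True}"
  define h where "h z = j (B.collapse x y (inv_into W j z))" for z
  have hj: "h (j w) = j (B.collapse x y w)" if "w \<in> W" for w
    using j that by (simp add: h_def)
  have coll_W: "B.collapse x y w \<in> W" if "w \<in> W" for w
    using that by (auto simp: B.collapse_def W_def)
  have coll_value: "word_value B (B.collapse x y w) = word_value B w" for w
    using xy by (simp add: B.collapse_def)
  have allowed_TT: "allowed True True w" for w :: "'a word"
    by (cases w) auto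
  have h: "h \<in> mhom (?K True True) (?K True True)"
  proof (rule mhomI)
    fix a b assume "a \<in> carrier (?K True True)" "b \<in> carrier (?K True True)"
    then obtain u v where ab: "a = j u" "b = j v" and uv: "u \<in> W" "v \<in> W"
      and val: "word_value B u = \<one>\<^bsub>B\<^esub>" "word_value B v = \<one>\<^bsub>B\<^esub>"
      by (auto simp: carr qj)
    show "h (a \<otimes>\<^bsub>?K True True\<^esub> b) = h a \<otimes>\<^bsub>?K True True\<^esub> h b"
      using B.collapse_mult[OF xy _ val(1) _ val(2)] uv
      by (simp add: ab N_mult allowed_TT hj mult_W coll_W) (simp add: W_def)
  qed (auto simp: carr qj hj coll_W coll_value allowed_TT N_one W_def B.collapse_def)
  have id: "(\<lambda>z. z) \<in> mhom (?K True True) (?K True True)" by (rule inclK)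
  have "arrow (?K True True) (\<lambda>z. z) (?K True True) = arrow (?K True True) h (?K True True)"
  proof (rule left_adjoint_jointly_epic[OF adj, where e = "E True True" and S = S and x = "?K True True"])
    show "E True True \<in> Ob (SpEx (Mon U) B)" using E by (simp add: SpEx_def)
    show "u \<in> Hom (SpEx (Mon U) B) (Dom (SpEx (Mon U) B) u) (E True True)" if "u \<in> S" for u
      using that \<iota> by (auto simp: S_def) (auto simp: \<iota>_def SpEx_def)
    show "arrow (?K True True) (\<lambda>z. z) (?K True True) \<in> Hom (Mon U) (on_ob ker_functor (E True True)) (?K True True)"
      "arrow (?K True True) h (?K True True) \<in> Hom (Mon U) (on_ob ker_functor (E True True)) (?K True True)"
      using arrow_in_Hom[OF K K id] arrow_in_Hom[OF K K h]
      by (simp_all add: ker_functor_def E_def split_ext_of_def)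
  next
    fix u assume "u \<in> S"
    then obtain l r where u: "u = \<iota> l r" and lr: "\<not> (l \<and> r)" by (auto simp: S_def)
    have "h z = z" if "z \<in> carrier (?K l r)" for z
      using that lr by (auto simp: carr hj B.collapse_def)
    then show "arrow (?K True True) (\<lambda>z. z) (?K True True) \<cdot>\<^bsub>Mon U\<^esub> on_ar ker_functor u
        = arrow (?K True True) h (?K True True) \<cdot>\<^bsub>Mon U\<^esub> on_ar ker_functor u"
      using inclK[of l r] by (simp add: u \<iota>_def ker_functor_def Cmp_arrow arrow_eq_iff)
  next
    fix E' v w
    assume v: "v \<in> Hom (SpEx (Mon U) B) (E True True) E'" and w: "w \<in> Hom (SpEx (Mon U) B) (E True True) E'"
      and eq: "\<And>u. u \<in> S \<Longrightarrow> v \<cdot>\<^bsub>SpEx (Mon U) B\<^esub> u = w \<cdot>\<^bsub>SpEx (Mon U) B\<^esub> u"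
    obtain vA vG where v_eq: "v = (E True True, vA, vG, E')" using v by (cases v) (auto simp: Hom_SpEx)
    obtain wA wG where w_eq: "w = (E True True, wA, wG, E')" using w by (cases w) (auto simp: Hom_SpEx)
    let ?G = "ext_G E'"
    have "vG \<in> Hom (Mon U) (N True True) ?G" "wG \<in> Hom (Mon U) (N True True) ?G"
      using v w by (auto simp: v_eq w_eq Hom_SpEx E_def split_ext_of_def)
    then obtain f g where f: "vG = arrow (N True True) f ?G" "f \<in> mhom (N True True) ?G"
      and g: "wG = arrow (N True True) g ?G" "g \<in> mhom (N True True) ?G"
      by (meson Hom_MonE)
    have on_piece: "f (j w) = g (j w)" if "w \<in> W" "allowed l r w" "\<iota> l r \<in> S" for w l r
      using eq[OF that(3)] that(1,2) incl[of l r]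
      by (auto simp: v_eq w_eq \<iota>_def SpEx_def f(1) g(1) Cmp_arrow arrow_eq_iff carr)
    have fg: "f (j w) = g (j w)" if w: "w \<in> W" for w
    proof (cases "\<exists>l r. \<iota> l r \<in> S \<and> allowed l r w")
      case True
      then show ?thesis using on_piece[OF w] by blast
    next
      case False
      then have "\<not> allowed True False w" "\<not> allowed False True w" by (auto simp: S_def)
      \<comment> \<open>A word with both letters is the product of one with \<open>\<lambda>\<close> only and one with \<open>\<rho>\<close> only; unlike
      the word itself, these factors need not lie over \<open>1\<close>.\<close>
      then obtain a b c where abc: "w = Both a b c" by (cases w) auto
      let ?l = "Lft a b" and ?r = "Rgt \<one>\<^bsub>B\<^esub> c"
      have lr: "?l \<in> W" "?r \<in> W" "w = word_mult B ?l ?r" using w by (auto simp: abc W_def)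
      have "f (j ?l) = g (j ?l)" "f (j ?r) = g (j ?r)"
        using on_piece[OF lr(1), of True False] on_piece[OF lr(2), of False True]
        by (simp_all add: S_def)
      moreover have "j w = j ?l \<otimes>\<^bsub>N True True\<^esub> j ?r" using lr by (simp add: N_mult)
      moreover have "j ?l \<in> carrier (N True True)" "j ?r \<in> carrier (N True True)"
        using lr by (auto simp: carr)
      ultimately show ?thesis by (simp add: mhomD(2)[OF f(2)] mhomD(2)[OF g(2)])
    qed
    then have "vG = wG" by (auto simp: f(1) g(1) arrow_eq_iff carr)
    then show "v = w"
      using SpEx_arrow_eqI[OF U, of "E True True" vA vG E' B wA wG] v w by (simp add: v_eq w_eq)
  qed
  moreover have wit: "Both x \<one>\<^bsub>B\<^esub> y \<in> W" using xy by (simp add: W_def)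
  then have "j (Both x \<one>\<^bsub>B\<^esub> y) \<in> carrier (?K True True)"
    using xy by (simp add: carr qj)
  ultimately have "j (Both x \<one>\<^bsub>B\<^esub> y) = j (Collapsed \<one>\<^bsub>B\<^esub>)"
    using hj[OF wit] by (simp add: arrow_eq_iff B.collapse_def)
  then show False
    using inj_onD[OF j _ wit, of "Collapsed \<one>\<^bsub>B\<^esub>"] by (simp add: W_def)
qed

text \<open>The bicyclic monoid \<open>\<langle>p, q | p q = 1\<rangle>\<close>, with \<open>q\<^sup>a p\<^sup>b\<close> represented by \<open>(a, b)\<close>; the truncated differences
count the letters that survive the cancellation of \<open>p\<^sup>b q\<^sup>c\<close>.\<close>

definition bicyclic :: "(nat \<times> nat) monoid" where
  "bicyclic = \<lparr>carrier = UNIV, mult = (\<lambda>(a, b) (c, d). (a + (c - b), d + (b - c))), one = (0, 0)\<rparr>"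

lemma monoid_bicyclic: "monoid bicyclic"
  by (rule monoidI) (auto simp: bicyclic_def)

theorem not_LACC_Mon:
  assumes U: "size_universe U"
  shows "\<not> LACC (Mon U)"
proof -
  have "small U (carrier bicyclic)"
    using small_Times[OF U small_nat[OF U] small_nat[OF U], of UNIV UNIV] by (simp add: bicyclic_def)
  then obtain j where j: "inj_on j (carrier bicyclic)" and jU: "j ` carrier bicyclic \<in> U"
    using small_encode[OF U] by (metis subset_refl)
  let ?B = "copy j bicyclic"
  have B: "?B \<in> Ob (Mon U)"
    using monoid_copy[OF monoid_bicyclic j] jU by (simp add: Ob_Mon)
  have cb: "z \<in> carrier bicyclic" for z by (simp add: bicyclic_def)
  have "j (0, 1) \<otimes>\<^bsub>?B\<^esub> j (1, 0) = \<one>\<^bsub>?B\<^esub>" "j (1, 0) \<otimes>\<^bsub>?B\<^esub> j (0, 1) \<noteq> \<one>\<^bsub>?B\<^esub>"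
    using inj_onD[OF j _ cb cb] by (auto simp: mult_copy[OF j cb cb]) (auto simp: bicyclic_def)
  then have "\<not> dedekind_finite ?B"
    using cb unfolding dedekind_finite_def by (auto simp del: One_nat_def)
  then show ?thesis
    using no_right_adjoint_if_not_dedekind_finite[OF U B] B unfolding LACC_def by blast
qed

theorem corollary2p5:
  fixes U :: "'u set set"
  assumes "size_universe U"
  shows "\<not> LACC (Mon U) \<and>
    (\<forall>B\<in>Ob (Mon U). powers_small U (carrier B) \<longrightarrow>
       (has_right_adjoint (SpEx (Mon U) B) (Mon U) ker_functor \<longleftrightarrow> dedekind_finite B))"
  using not_LACC_Mon[OF assms] dedekind_finite_right_adjoint[OF assms]
    no_right_adjoint_if_not_dedekind_finite[OF assms]
  by blast

end
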